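(* Let $r$ be a real number with $1\le r<2$. The Model A puzzle with hoop radius $r$ cannot be solved; that is, there do not exist (1) a continuous family $(g_t)_{t\in[0,1]}$ of orientation-preserving isometries of $\mathbb{R}^3$ with $g_0=\mathrm{id}$, and (2) a continuous map $\gamma:[0,1]\times[0,1]\to\mathbb{R}^3$, $(t,s)\mapsto\gamma_t(s)$, such that, writing $H_t=g_t(H^-)$, all of the following hold: (a) $H_1=H^+$; (b) $\gamma_0$ and $\gamma_1$ are both injective parametrizations of the polygonal line $\Gamma$ from $(0,-1,0)$ to $(0,1,0)$; (c) for every $t\in[0,1]$, $\gamma_t(0)=(0,-1,0)$ and $\gamma_t(1)=(0,1,0)$, and $\gamma_t(s)$ lies in $\{z>0\}$ for all $0<s<1$; (d) for every $t\in[0,1]$, $H_t\subset\{z>0\}$; (e) for every $t\in[0,1]$, $\gamma_t([0,1])\cap H_t=\emptyset$, $\gamma_t([0,1])\cap L=\emptyset$ and $H_t\cap L=\emptyset$.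
   Context: Use coordinates $(x,y,z)$ on $\mathbb{R}^3$. The Model A puzzle consists of the following objects. The table is the plane $z=0$. The pole with its ending circle is $$L=\{(0,0,z):0\le z\le 1\}\cup\{(x,y,z): y=0,\ x^2+(z-2)^2=1\},$$ which is fixed. The rope is initially the polygonal line $\Gamma$ passing successively through $(0,-1,0)$, $(0,-1,2)$, $(0,1,2)$, $(0,1,0)$. Its two endpoints are attached to the table. The rope may be moved by arbitrary homotopies fixing its endpoints (it may cross itself and has no length restriction). The moving hoop is a rigid circle of radius $r$, initially $$H^-=\{(x,y,z): y=-\tfrac12,\ x^2+(z-2)^2=r^2\}.$$ The target position of the hoop is $$H^+=\{(x,y,z): y=\tfrac12,\ x^2+(z-2)^2=r^2\},$$ with the rope back in the position $\Gamma$. During the motion the hoop and the rope may not touch each other, nor the pole with its ending circle, nor the plane $z=0$ (except that the endpoints of the rope stay attached to it). Everything takes place in the half-space above the table. *)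

theory Defs
  imports "HOL-Analysis.Analysis"
begin

definition upper_half_space :: "(real^3) set" where
  "upper_half_space = {p. 0 < p $ 3}"

definition pole :: "(real^3) set" where
  "pole = {p. p $ 1 = 0 \<and> p $ 2 = 0 \<and> 0 \<le> p $ 3 \<and> p $ 3 \<le> 1}
        \<union> {p. p $ 2 = 0 \<and> (p $ 1)\<^sup>2 + (p $ 3 - 2)\<^sup>2 = 1}"

definition rope_polygon :: "(real^3) set" where
  "rope_polygon =
     closed_segment (vector [0, -1, 0]) (vector [0, -1, 2])
   \<union> closed_segment (vector [0, -1, 2]) (vector [0, 1, 2])
   \<union> closed_segment (vector [0, 1, 2]) (vector [0, 1, 0])"

definition hoop_minus :: "real \<Rightarrow> (real^3) set" where
  "hoop_minus r = {p. p $ 2 = - 1 / 2 \<and> (p $ 1)\<^sup>2 + (p $ 3 - 2)\<^sup>2 = r\<^sup>2}"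

definition hoop_plus :: "real \<Rightarrow> (real^3) set" where
  "hoop_plus r = {p. p $ 2 = 1 / 2 \<and> (p $ 1)\<^sup>2 + (p $ 3 - 2)\<^sup>2 = r\<^sup>2}"

(* An isometry of Euclidean space is affine, so f - f 0 is its linear part. *)
definition orientation_preserving_isometry :: "(real^3 \<Rightarrow> real^3) \<Rightarrow> bool" where
  "orientation_preserving_isometry f \<longleftrightarrow>
     (\<forall>x y. dist (f x) (f y) = dist x y) \<and> 0 < det (matrix (\<lambda>x. f x - f 0))"

end

theory Submission
  imports Defs
begin

text \<open>Write \<open>P = (0, 0, 1)\<close> for the point where the pole meets the ring. Close the rope to a loop
\<open>K\<close> based at \<open>P\<close> by running down the pole, along the table, along the rope and back; the hoop
never meets it. The spherical cap bounded by the hoop on the sphere through the hoop and \<open>P\<close>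
(the side not containing \<open>P\<close>) becomes a flat disc after inversion at \<open>P\<close>, while the ring becomes
a line. Two disjoint circles that start unlinked stay unlinked, so the cap never meets the ring and
lifts to the double cover of space branched along the ring. Counting the crossings of the lifted
loop with one fixed lift of the cap is then invariant under the motion.

Which lift is carried along is decided by the mean over the hoop of the function
\<open>w(p) = 1 - |p - (0, 0, 2)|^2 + 2 i y\<close>, whose argument is the angle around the ring. If
\<open>r \<ge> 1\<close>, this mean has non-positive real part, so it never crosses the positive axis, which
corresponds to the disc spanned by the ring: a large hoop always has its larger part on the side
where it began. Hence the crossing number counted on that side is 1 at the beginning but would be
0 at the end.\<close>

section \<open>Unlinked circles and the cap\<close>

text \<open>The linear part has a real kernel direction \<open>(u, v)\<close>; sliding a zero along
  it carries it from inside the disc to the circle.\<close>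

lemma real_affine_zero_on_circle:
  fixes A B D :: complex and x z :: real
  assumes det: "Re B * Im D - Im B * Re D = 0"
    and zero: "A + of_real x * B + of_real z * D = 0" and disc: "x\<^sup>2 + z\<^sup>2 \<le> 1"
  shows "\<exists>x z :: real. x\<^sup>2 + z\<^sup>2 = 1 \<and> A + of_real x * B + of_real z * D = 0"
proof -
  obtain u v :: real where uv: "(u, v) \<noteq> (0, 0)" "of_real u * B + of_real v * D = 0"
  proof -
    consider "Re B \<noteq> 0 \<or> Re D \<noteq> 0" | "Im B \<noteq> 0 \<or> Im D \<noteq> 0" | "B = 0" "D = 0"
      by (auto simp: complex_eq_iff)
    then show ?thesis
    proof cases
      case 1
      then show ?thesis using det
        by (intro that[of "Re D" "- Re B"]) (auto simp: complex_eq_iff algebra_simps)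
    next
      case 2
      then show ?thesis using det
        by (intro that[of "Im D" "- Im B"]) (auto simp: complex_eq_iff algebra_simps)
    next
      case 3
      then show ?thesis by (intro that[of 1 0]) auto
    qed
  qed
  define a where "a = u\<^sup>2 + v\<^sup>2"
  define b where "b = x * u + z * v"
  define c where "c = x\<^sup>2 + z\<^sup>2 - 1"
  have "a > 0" using uv(1) by (auto simp: a_def sum_power2_gt_zero_iff)
  have "b\<^sup>2 - a * c \<ge> 0"
    using \<open>a > 0\<close> disc by (smt (verit) c_def mult_nonneg_nonpos zero_le_power2)
  \<comment> \<open>The larger root of \<open>a * k^2 + 2 * b * k + c\<close>, which is the squared
    norm of \<open>(x + k * u, z + k * v)\<close> minus 1.\<close>
  define k where "k = (sqrt (b\<^sup>2 - a * c) - b) / a"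
  have "a * k + b = sqrt (b\<^sup>2 - a * c)"
    using \<open>a > 0\<close> by (simp add: k_def)
  then have "(a * k + b)\<^sup>2 = b\<^sup>2 - a * c"
    using \<open>b\<^sup>2 - a * c \<ge> 0\<close> by simp
  then have "a * (a * k\<^sup>2 + 2 * b * k + c) = 0"
    by (simp add: power2_eq_square algebra_simps)
  then have "a * k\<^sup>2 + 2 * b * k + c = 0"
    using \<open>a > 0\<close> by simp
  then have "(x + k * u)\<^sup>2 + (z + k * v)\<^sup>2 = 1"
    by (simp add: a_def b_def c_def power2_eq_square algebra_simps)
  moreover have "A + of_real (x + k * u) * B + of_real (z + k * v) * D
      = (A + of_real x * B + of_real z * D) + of_real k * (of_real u * B + of_real v * D)"
    by (simp add: algebra_simps)
  ultimately show ?thesis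
    using zero uv(2) by (intro exI[of _ "x + k * u"] exI[of _ "z + k * v"] conjI) simp_all
qed

text \<open>A zero inside the disc, but none on the circle, forces the affine map to be nondegenerate, so
having such a zero is an open condition; it is also closed by compactness.\<close>

lemma affine_family_nonzero_on_disc:
  fixes A B D :: "real \<Rightarrow> complex"
  assumes cont: "continuous_on {0..1} A" "continuous_on {0..1} B" "continuous_on {0..1} D"
    and circle: "\<And>t x z. t \<in> {0..1} \<Longrightarrow> x\<^sup>2 + z\<^sup>2 = 1 \<Longrightarrow> A t + of_real x * B t + of_real z * D t \<noteq> 0"
    and start: "\<And>x z. x\<^sup>2 + z\<^sup>2 \<le> 1 \<Longrightarrow> A 0 + of_real x * B 0 + of_real z * D 0 \<noteq> 0"
    and t: "t \<in> {0..1}" and disc: "x\<^sup>2 + z\<^sup>2 \<le> 1"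
  shows "A t + of_real x * B t + of_real z * D t \<noteq> 0"
proof -
  define S where "S = {t \<in> {0..1}. \<exists>x z. x\<^sup>2 + z\<^sup>2 \<le> 1 \<and> A t + of_real x * B t + of_real z * D t = 0}"
  \<comment> \<open>Cramer's rule: the candidate zero is
    \<open>(X / \<Delta>, Z / \<Delta>)\<close>, and \<open>Q < 0\<close> says that it exists and
    lies in the open disc.\<close>
  define \<Delta> where "\<Delta> = (\<lambda>t. Re (B t) * Im (D t) - Im (B t) * Re (D t))"
  define X where "X = (\<lambda>t. Im (A t) * Re (D t) - Re (A t) * Im (D t))"
  define Z where "Z = (\<lambda>t. Re (A t) * Im (B t) - Im (A t) * Re (B t))"
  define Q where "Q = (\<lambda>t. (X t)\<^sup>2 + (Z t)\<^sup>2 - (\<Delta> t)\<^sup>2)"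
  have S_iff: "t \<in> S \<longleftrightarrow> Q t < 0" if t: "t \<in> {0..1}" for t
  proof
    assume "t \<in> S"
    then obtain x z where xz: "x\<^sup>2 + z\<^sup>2 \<le> 1" "A t + of_real x * B t + of_real z * D t = 0"
      by (auto simp: S_def)
    have "\<Delta> t \<noteq> 0"
      using real_affine_zero_on_circle[OF _ xz(2,1)] circle[OF t] by (auto simp: \<Delta>_def)
    have "x\<^sup>2 + z\<^sup>2 < 1"
      using xz circle[OF t, of x z] by force
    have re: "Re (A t) = - x * Re (B t) - z * Re (D t)" and im: "Im (A t) = - x * Im (B t) - z * Im (D t)"
      using xz(2) by (auto simp: complex_eq_iff algebra_simps add_eq_0_iff)
    have "X t = x * \<Delta> t" "Z t = z * \<Delta> t"
      unfolding X_def Z_def \<Delta>_def re im by (simp_all add: algebra_simps)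
    then have "Q t = (x\<^sup>2 + z\<^sup>2 - 1) * (\<Delta> t)\<^sup>2"
      by (simp add: Q_def algebra_simps)
    then show "Q t < 0"
      using \<open>\<Delta> t \<noteq> 0\<close> \<open>x\<^sup>2 + z\<^sup>2 < 1\<close> by (simp add: mult_neg_pos)
  next
    assume Q: "Q t < 0"
    then have "\<Delta> t \<noteq> 0" by (auto simp: Q_def not_sum_power2_lt_zero)
    define x where "x = X t / \<Delta> t"
    define z where "z = Z t / \<Delta> t"
    have "x\<^sup>2 + z\<^sup>2 = ((X t)\<^sup>2 + (Z t)\<^sup>2) / (\<Delta> t)\<^sup>2"
      by (simp add: x_def z_def power_divide add_divide_distrib)
    also have "\<dots> \<le> 1"
      using Q \<open>\<Delta> t \<noteq> 0\<close> by (simp add: Q_def)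
    finally have "x\<^sup>2 + z\<^sup>2 \<le> 1" .
    moreover have xz: "\<Delta> t * x = X t" "\<Delta> t * z = Z t"
      using \<open>\<Delta> t \<noteq> 0\<close> by (simp_all add: x_def z_def)
    have "\<Delta> t * (u + x * v + z * w) = \<Delta> t * u + X t * v + Z t * w" for u v w
      unfolding xz[symmetric] by (simp add: algebra_simps)
    note * = this
    have "\<Delta> t * (Re (A t) + x * Re (B t) + z * Re (D t)) = 0"
      "\<Delta> t * (Im (A t) + x * Im (B t) + z * Im (D t)) = 0"
      unfolding * unfolding X_def Z_def \<Delta>_def by (simp_all add: algebra_simps)
    ultimately show "t \<in> S"
      using \<open>\<Delta> t \<noteq> 0\<close> t by (auto simp: S_def complex_eq_iff)
  qed
  have "continuous_on {0..1} Q"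
    unfolding Q_def X_def Z_def \<Delta>_def by (intro continuous_intros cont)
  then have "openin (top_of_set {0..1}) ({0..1} \<inter> Q -` {..<0})"
    by (rule continuous_openin_preimage_gen) simp
  moreover have "{0..1} \<inter> Q -` {..<0} = S"
    using S_iff by (auto simp: S_def)
  ultimately have op: "openin (top_of_set {0..1}) S" by simp
  define W where "W = (\<lambda>(t, p :: real \<times> real). A t + of_real (fst p) * B t + of_real (snd p) * D t)"
  have W: "continuous_on ({0..1} \<times> cball 0 1) W"
    unfolding W_def case_prod_unfold
    by (intro continuous_intros continuous_on_compose2[OF cont(1)] continuous_on_compose2[OF cont(2)]
        continuous_on_compose2[OF cont(3)]) auto
  have "closed (({0..1} \<times> cball 0 1) \<inter> W -` {0})"
    by (rule continuous_closed_preimage[OF W]) (auto intro!: closed_Times)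
  then have "compact (({0..1} \<times> cball 0 1) \<inter> (({0..1} \<times> cball 0 1) \<inter> W -` {0}))"
    by (intro compact_Int_closed compact_Times compact_Icc compact_cball)
  then have "compact (({0..1} \<times> cball 0 1) \<inter> W -` {0})"
    by (simp only: Int_left_absorb)
  then have "compact (fst ` (({0..1} \<times> cball 0 1) \<inter> W -` {0}))"
    by (intro compact_continuous_image continuous_intros)
  moreover have "fst ` (({0..1} \<times> cball 0 1) \<inter> W -` {0}) = S"
  proof (intro set_eqI iffI)
    fix t assume "t \<in> fst ` (({0..1} \<times> cball 0 1) \<inter> W -` {0})"
    then obtain x z where "t \<in> {0..1}" "norm (x, z) \<le> 1" "W (t, x, z) = 0" by auto
    then show "t \<in> S" by (auto simp: S_def W_def norm_Pair)
  next
    fix t assume "t \<in> S"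
    then obtain x z where "t \<in> {0..1}" "x\<^sup>2 + z\<^sup>2 \<le> 1" "A t + of_real x * B t + of_real z * D t = 0"
      by (auto simp: S_def)
    then have "(t, x, z) \<in> ({0..1} \<times> cball 0 1) \<inter> W -` {0}"
      by (simp add: W_def norm_Pair)
    then show "t \<in> fst ` (({0..1} \<times> cball 0 1) \<inter> W -` {0})"
      by (metis fst_conv image_eqI)
  qed
  ultimately have "closedin (top_of_set {0..1}) S"
    using compact_imp_closed closed_subset by (metis (no_types, lifting) S_def mem_Collect_eq subsetI)
  moreover have "0 \<notin> S" using start by (auto simp: S_def)
  ultimately have "S = {}"
    using op connected_clopen[of "{0..1::real}"] by (metis atLeastAtMost_iff connected_Icc order_refl zero_le_one)
  with t disc show ?thesis by (auto simp: S_def)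
qed

text \<open>Jensen's inequality with unnormalised weights 1, \<open>u\<close>, \<open>v\<close>. It
  supplies the cone condition in \<open>cap_not_opposite\<close>.\<close>

lemma convex_square_bound:
  fixes a b d u v :: real
  assumes "0 \<le> u" "0 \<le> v"
  shows "(a + u * b + v * d)\<^sup>2 \<le> (a\<^sup>2 + u * b\<^sup>2 + v * d\<^sup>2) * (1 + u + v)"
proof -
  have "(a\<^sup>2 + u * b\<^sup>2 + v * d\<^sup>2) * (1 + u + v) - (a + u * b + v * d)\<^sup>2
      = u * (a - b)\<^sup>2 + v * (a - d)\<^sup>2 + u * v * (b - d)\<^sup>2"
    by (simp add: power2_eq_square algebra_simps)
  also have "\<dots> \<ge> 0" using assms by simp
  finally show ?thesis by simp
qed

text \<open>The zero set is the circle of radius \<open>r\<close> around \<open>c\<close> in the plane with unit normal \<open>n\<close>; real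
multiples of a fixed value cut out the spheres through that circle.\<close>

definition circle_eq :: "real \<Rightarrow> real^3 \<Rightarrow> real^3 \<Rightarrow> real^3 \<Rightarrow> complex" where
  "circle_eq r c n p = Complex ((norm (p - c))\<^sup>2 - r\<^sup>2) (n \<bullet> (p - c))"

text \<open>The function \<open>w\<close> of the overview. Its sign makes the open disc spanned by
  the ring the set of positive real values.\<close>

definition ring_eq :: "real^3 \<Rightarrow> complex" where
  "ring_eq p = Complex (1 - (p $ 1)\<^sup>2 - (p $ 2)\<^sup>2 - (p $ 3 - 2)\<^sup>2) (2 * p $ 2)"

text \<open>The mean of \<open>ring_eq\<close> over two antipodal points of a circle of radius \<open>r\<close> around \<open>c\<close>.\<close>

definition mean_ring_eq :: "real \<Rightarrow> real^3 \<Rightarrow> complex" where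
  "mean_ring_eq r c = ring_eq c - of_real (r\<^sup>2)"

text \<open>The affine function on the disc spanned by the ring that agrees with \<open>circle_eq\<close> on the
ring itself. The circle is unlinked from the ring iff it has no zero on the disc.\<close>

definition disc_trace :: "real \<Rightarrow> real^3 \<Rightarrow> real^3 \<Rightarrow> real \<Rightarrow> real \<Rightarrow> complex" where
  "disc_trace r c n x z = circle_eq r c n (vector [x, 0, 2 + z]) + of_real (1 - x\<^sup>2 - z\<^sup>2)"

lemma power2_norm_3: "(norm (v :: real^3))\<^sup>2 = (v $ 1)\<^sup>2 + (v $ 2)\<^sup>2 + (v $ 3)\<^sup>2"
  unfolding power2_norm_eq_inner by (simp add: inner_vec_def sum_3 power2_eq_square)

lemma disc_trace_affine:
  "disc_trace r c n x z = disc_trace r c n 0 0 +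
     of_real x * Complex (- 2 * c $ 1) (n $ 1) + of_real z * Complex (- 2 * (c $ 3 - 2)) (n $ 3)"
  by (simp add: disc_trace_def circle_eq_def complex_eq_iff power2_norm_3 inner_vec_def sum_3)
    (simp add: power2_eq_square algebra_simps)

text \<open>For \<open>r \<ge> 1\<close> only the borderline case \<open>r = 1\<close> with
  concentric circles could give a non-negative real; \<open>disc_trace\<close> then vanishes at the
  centre of the disc.\<close>

lemma mean_ring_eq_notin_nonneg_Reals:
  assumes "1 \<le> r" and unlinked: "\<And>x z. x\<^sup>2 + z\<^sup>2 \<le> 1 \<Longrightarrow> disc_trace r c n x z \<noteq> 0"
  shows "mean_ring_eq r c \<notin> \<real>\<^sub>\<ge>\<^sub>0"
proof
  assume "mean_ring_eq r c \<in> \<real>\<^sub>\<ge>\<^sub>0"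
  then have c2: "c $ 2 = 0" and le: "(c $ 1)\<^sup>2 + (c $ 3 - 2)\<^sup>2 + r\<^sup>2 \<le> 1"
    by (auto simp: mean_ring_eq_def ring_eq_def complex_nonneg_Reals_iff)
  have "r\<^sup>2 \<ge> 1" using assms(1) by (simp add: power_le_one_iff one_le_power)
  have nn: "0 \<le> (c $ 1)\<^sup>2 + (c $ 3 - 2)\<^sup>2" by simp
  with le \<open>r\<^sup>2 \<ge> 1\<close> have "(c $ 1)\<^sup>2 + (c $ 3 - 2)\<^sup>2 = 0" "r\<^sup>2 = 1" by linarith+
  then have "c $ 1 = 0" "c $ 3 = 2" "r\<^sup>2 = 1" by (auto simp: sum_power2_eq_zero_iff)
  then have "disc_trace r c n 0 0 = 0"
    using c2 by (simp add: disc_trace_def circle_eq_def complex_eq_iff power2_norm_3 inner_vec_def sum_3)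
  then show False using unlinked[of 0 0] by simp
qed

text \<open>The first equation says that \<open>p\<close> lies on the cap. A point \<open>q\<close> corresponds to the null vector
\<open>(|q|^2, q, 1)\<close> of the quadratic form \<open>N m - |v|^2\<close> on \<open>R^5\<close>, on which \<open>circle_eq\<close> and \<open>ring_eq\<close>
become linear. The positive combination of the vectors of \<open>p\<close>, of the mean of two antipodal points
of the circle and of \<open>P\<close> is annihilated by both and lies in the closed forward cone, hence gives
a zero of \<open>disc_trace\<close> in the disc.\<close>

lemma cap_not_opposite:
  assumes unlinked: "\<And>x z. x\<^sup>2 + z\<^sup>2 \<le> 1 \<Longrightarrow> disc_trace r c n x z \<noteq> 0"
    and "0 \<le> a" "0 \<le> b"
    and cap: "circle_eq r c n p = - of_real a * circle_eq r c n (vector [0, 0, 1])"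
  shows "ring_eq p \<noteq> - of_real b * mean_ring_eq r c"
proof
  assume opp: "ring_eq p = - of_real b * mean_ring_eq r c"
  define m where "m = 1 + b + a"
  have "m > 0" using assms(2,3) by (simp add: m_def)
  \<comment> \<open>Coordinates are centred at (0, 0, 2) and the weights are 1, \<open>b\<close>,
    \<open>a\<close>. The constants 0, -1, 1 come from P; \<open>r^2\<close> in \<open>N\<close>
    comes from averaging squared norms over antipodal points.\<close>
  define X where "X = p $ 1 + b * c $ 1 + a * 0"
  define Y where "Y = p $ 2 + b * c $ 2 + a * 0"
  define Z where "Z = (p $ 3 - 2) + b * (c $ 3 - 2) + a * (- 1)"
  define N where "N = ((p $ 1)\<^sup>2 + (p $ 2)\<^sup>2 + (p $ 3 - 2)\<^sup>2)
     + b * ((c $ 1)\<^sup>2 + (c $ 2)\<^sup>2 + (c $ 3 - 2)\<^sup>2 + r\<^sup>2) + a * 1"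
  have "Im (ring_eq p) = - b * Im (mean_ring_eq r c)" "Re (ring_eq p) = - b * Re (mean_ring_eq r c)"
    unfolding opp by simp_all
  note * = this[unfolded ring_eq_def mean_ring_eq_def minus_complex.sel Re_complex_of_real
      Im_complex_of_real complex.sel]
  have Y: "Y = 0" using *(1) unfolding Y_def by argo
  have N: "N = m" using *(2) unfolding N_def m_def by argo
  have "X\<^sup>2 + Z\<^sup>2 \<le> ((p $ 1)\<^sup>2 + b * (c $ 1)\<^sup>2 + a * 0\<^sup>2) * m + ((p $ 3 - 2)\<^sup>2 + b * (c $ 3 - 2)\<^sup>2 + a * (-1)\<^sup>2) * m"
    unfolding X_def Z_def m_def using assms(2,3) by (intro add_mono convex_square_bound)
  also have "\<dots> = (N - (p $ 2)\<^sup>2 - b * ((c $ 2)\<^sup>2 + r\<^sup>2)) * m"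
    by (simp add: N_def algebra_simps)
  also have "\<dots> \<le> N * m"
    using \<open>m > 0\<close> assms(3) by (intro mult_right_mono) (auto intro: order_trans[of _ 0])
  finally have "(X / m)\<^sup>2 + (Z / m)\<^sup>2 \<le> 1"
    using \<open>m > 0\<close> N by (simp add: power_divide add_divide_distrib[symmetric] power2_eq_square)
  moreover have "of_real m * disc_trace r c n (X / m) (Z / m) = 0"
  proof -
    have "of_real m * disc_trace r c n (X / m) (Z / m) = of_real m * disc_trace r c n 0 0 +
      of_real X * Complex (- 2 * c $ 1) (n $ 1) + of_real Z * Complex (- 2 * (c $ 3 - 2)) (n $ 3)"
      using \<open>m > 0\<close> by (subst disc_trace_affine) (simp add: algebra_simps)
    also have "\<dots> = circle_eq r c n p + of_real a * circle_eq r c n (vector [0, 0, 1])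
        + Complex (m - N + 2 * c $ 2 * Y) (- (n $ 2 * Y))"
      by (simp add: disc_trace_def circle_eq_def complex_eq_iff power2_norm_3 inner_vec_def sum_3)
        (simp add: X_def Y_def Z_def N_def m_def power2_eq_square algebra_simps)
    also have "\<dots> = circle_eq r c n p + of_real a * circle_eq r c n (vector [0, 0, 1])"
      using Y N by (simp add: complex_eq_iff)
    finally show ?thesis using cap by simp
  qed
  ultimately show False using unlinked \<open>m > 0\<close> by auto
qed

section \<open>Continuous logarithms of loops\<close>

lemma log_difference_constant:
  fixes g h :: "'a::topological_space \<Rightarrow> complex"
  assumes "connected S" "continuous_on S g" "continuous_on S h"
    and "\<And>x. x \<in> S \<Longrightarrow> exp (g x) = exp (h x)"
  shows "(\<lambda>x. g x - h x) constant_on S"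
proof (rule continuous_discrete_range_constant)
  show "connected S" by fact
  show "continuous_on S (\<lambda>x. g x - h x)"
    using assms by (intro continuous_intros)
  fix x assume x: "x \<in> S"
  show "\<exists>e>0. \<forall>y. y \<in> S \<and> g y - h y \<noteq> g x - h x \<longrightarrow> e \<le> cmod (g y - h y - (g x - h x))"
  proof (intro exI[of _ "2 * pi"] conjI allI impI)
    fix y assume y: "y \<in> S \<and> g y - h y \<noteq> g x - h x"
    have "exp (g y - h y - (g x - h x)) = 1"
      using assms(4) x y by (simp add: exp_diff)
    then obtain n :: int where n: "g y - h y - (g x - h x) = of_real (of_int (2 * n) * pi) * \<i>"
      by (metis complex_eq_iff exp_eq_1 mult.commute Re_complex_of_real Im_complex_of_real
          Im_i_times Re_i_times minus_zero)
    with y have "n \<noteq> 0" by auto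
    then have "\<bar>real_of_int n\<bar> \<ge> 1" by linarith
    then have "2 * \<bar>real_of_int n\<bar> * pi \<ge> 2 * 1 * pi"
      by (intro mult_right_mono mult_left_mono) auto
    then show "2 * pi \<le> cmod (g y - h y - (g x - h x))"
      unfolding n by (simp add: norm_mult abs_mult)
  qed simp
qed

text \<open>For a continuous loop without zeros this expresses winding number 0 around the
  origin.\<close>

definition closed_log_on :: "real \<Rightarrow> real \<Rightarrow> (real \<Rightarrow> complex) \<Rightarrow> bool" where
  "closed_log_on a b f \<longleftrightarrow>
     (\<exists>l. continuous_on {a..b} l \<and> (\<forall>s\<in>{a..b}. exp (l s) = f s) \<and> l a = l b)"

lemma closed_log_on_mult_const:
  assumes "closed_log_on a b f" "c \<noteq> 0"
  shows "closed_log_on a b (\<lambda>s. c * f s)"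
proof -
  from assms(1) obtain l where "continuous_on {a..b} l" "\<forall>s\<in>{a..b}. exp (l s) = f s" "l a = l b"
    by (auto simp: closed_log_on_def)
  then show ?thesis
    unfolding closed_log_on_def
    by (intro exI[of _ "\<lambda>s. Ln c + l s"]) (auto simp: exp_add assms(2) intro!: continuous_intros)
qed

lemma closed_log_on_slit_plane:
  assumes "continuous_on {a..b} f" "f a = f b" "\<And>s. s \<in> {a..b} \<Longrightarrow> f s \<notin> \<real>\<^sub>\<le>\<^sub>0"
  shows "closed_log_on a b f"
proof -
  have "exp (Ln (f s)) = f s" if "s \<in> {a..b}" for s
    using assms(3)[OF that] by (intro exp_Ln) auto
  then show ?thesis
    unfolding closed_log_on_def using assms
    by (intro exI[of _ "\<lambda>s. Ln (f s)"]) (auto intro!: continuous_intros)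
qed

text \<open>A logarithm \<open>L\<close> exists on the whole contractible rectangle. Its increment
  over \<open>[a, b]\<close> is constant in \<open>u\<close>, and it is 0 at \<open>t\<close>, where
  \<open>L\<close> differs from \<open>l\<close> by a constant.\<close>

lemma closed_log_on_homotopy:
  fixes G :: "real \<Rightarrow> real \<Rightarrow> complex"
  assumes ab: "a \<le> b"
    and G: "continuous_on ({0..1} \<times> {a..b}) (\<lambda>(t, s). G t s)"
    and nz: "\<And>t s. t \<in> {0..1} \<Longrightarrow> s \<in> {a..b} \<Longrightarrow> G t s \<noteq> 0"
    and loop: "\<And>t. t \<in> {0..1} \<Longrightarrow> G t a = G t b"
    and t: "t \<in> {0..1}" "t' \<in> {0..1}" and cl: "closed_log_on a b (G t)"
  shows "closed_log_on a b (G t')"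
proof -
  have "contractible ({0..1::real} \<times> {a..b})"
    by (intro convex_imp_contractible convex_Times) auto
  from continuous_logarithm_on_contractible[OF G this]
  obtain L where L: "continuous_on ({0..1} \<times> {a..b}) L"
    and "\<And>x. x \<in> {0..1} \<times> {a..b} \<Longrightarrow> (\<lambda>(t, s). G t s) x = exp (L x)"
    using nz by (metis (no_types, lifting) SigmaE case_prod_conv)
  then have eL: "exp (L (u, s)) = G u s" if "u \<in> {0..1}" "s \<in> {a..b}" for u s
    using that by fastforce
  have cs: "continuous_on {a..b} (\<lambda>s. L (u, s))" if "u \<in> {0..1}" for u
    by (rule continuous_on_compose2[OF L]) (use that in \<open>auto intro!: continuous_intros\<close>)
  have ct: "continuous_on {0..1} (\<lambda>u. L (u, s))" if "s \<in> {a..b}" for s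
    by (rule continuous_on_compose2[OF L]) (use that in \<open>auto intro!: continuous_intros\<close>)
  have "(\<lambda>u. L (u, a) - L (u, b)) constant_on {0..1}"
    by (rule log_difference_constant) (use ab loop eL ct in auto)
  then obtain k where k: "\<And>u. u \<in> {0..1} \<Longrightarrow> L (u, a) - L (u, b) = k"
    by (auto simp: constant_on_def)
  from cl obtain l where l: "continuous_on {a..b} l" "\<forall>s\<in>{a..b}. exp (l s) = G t s" "l a = l b"
    by (auto simp: closed_log_on_def)
  have "(\<lambda>s. l s - L (t, s)) constant_on {a..b}"
    by (rule log_difference_constant) (use l eL t cs in auto)
  then obtain k' where k': "\<And>s. s \<in> {a..b} \<Longrightarrow> l s - L (t, s) = k'"
    by (auto simp: constant_on_def)
  have "k = 0"
    using k[OF t(1)] k'[of a] k'[of b] l(3) ab by (auto simp: algebra_simps)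
  then show ?thesis
    unfolding closed_log_on_def using cs[OF t(2)] eL[OF t(2)] k[OF t(2)]
    by (intro exI[of _ "\<lambda>s. L (t', s)"]) auto
qed

text \<open>The loop makes one clockwise turn. Comparing \<open>l\<close> with branches on the two
  closed half-planes leaves their mismatch 2 pi i on the negative axis.\<close>

lemma no_closed_log_on_one_turn:
  fixes f :: "real \<Rightarrow> complex"
  assumes ord: "a \<le> p" "p \<le> q" "q \<le> b"
    and f: "continuous_on {a..b} f" and nz: "\<And>s. s \<in> {a..b} \<Longrightarrow> f s \<noteq> 0"
    and up1: "\<And>s. s \<in> {a..p} \<Longrightarrow> 0 \<le> Im (f s)"
    and low: "\<And>s. s \<in> {p..q} \<Longrightarrow> Im (f s) \<le> 0"
    and up2: "\<And>s. s \<in> {q..b} \<Longrightarrow> 0 \<le> Im (f s)"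
    and pos: "0 < Re (f p)" and neg: "Re (f q) < 0"
  shows "\<not> closed_log_on a b f"
proof
  assume "closed_log_on a b f"
  then obtain l where l: "continuous_on {a..b} l" "\<And>s. s \<in> {a..b} \<Longrightarrow> exp (l s) = f s" "l a = l b"
    by (auto simp: closed_log_on_def)
  have up_slit: "- \<i> * z \<notin> \<real>\<^sub>\<le>\<^sub>0" if "0 \<le> Im z" "z \<noteq> 0" for z :: complex
    using that by (auto simp: complex_nonpos_Reals_iff complex_eq_iff)
  have low_slit: "\<i> * z \<notin> \<real>\<^sub>\<le>\<^sub>0" if "Im z \<le> 0" "z \<noteq> 0" for z :: complex
    using that by (auto simp: complex_nonpos_Reals_iff complex_eq_iff)
  \<comment> \<open>\<open>U\<close> is cut along the negative imaginary axis and \<open>D\<close>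
    along the positive one, so each is continuous on its closed half-plane without 0.\<close>
  define U where "U = (\<lambda>z. Ln (- \<i> * z) + \<i> * pi / 2)"
  define D where "D = (\<lambda>z. Ln (\<i> * z) - \<i> * pi / 2)"
  have half: "exp (\<i> * complex_of_real pi / 2) = \<i>"
    using exp_Euler[of "of_real pi / 2"] by (simp add: mult.commute cos_of_real[symmetric] sin_of_real[symmetric])
  have rot: "- (\<i> * z * \<i>) = z" for z
    by (simp add: complex_eq_iff)
  have eU: "exp (U z) = z" and eD: "exp (D z) = z" if "z \<noteq> 0" for z
    using that half by (auto simp: U_def D_def exp_add exp_diff rot)
  have cU: "continuous_on A (\<lambda>s. U (f s))"
    if "A \<subseteq> {a..b}" "\<And>s. s \<in> A \<Longrightarrow> 0 \<le> Im (f s)" for A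
    unfolding U_def
    by (intro continuous_intros continuous_on_subset[OF f that(1)] up_slit) (use that nz in auto)
  have cD: "continuous_on A (\<lambda>s. D (f s))"
    if "A \<subseteq> {a..b}" "\<And>s. s \<in> A \<Longrightarrow> Im (f s) \<le> 0" for A
    unfolding D_def
    by (intro continuous_intros continuous_on_subset[OF f that(1)] low_slit) (use that nz in auto)
  have "(\<lambda>s. l s - U (f s)) constant_on {a..p}"
    by (rule log_difference_constant)
      (use l ord up1 nz in \<open>auto intro!: cU continuous_on_subset[OF l(1)] simp: eU\<close>)
  then have 1: "l a - U (f a) = l p - U (f p)"
    using ord unfolding constant_on_def by fastforce
  have "(\<lambda>s. l s - D (f s)) constant_on {p..q}"
    by (rule log_difference_constant)
      (use l ord low nz in \<open>auto intro!: cD continuous_on_subset[OF l(1)] simp: eD\<close>)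
  then have 2: "l p - D (f p) = l q - D (f q)"
    using ord unfolding constant_on_def by fastforce
  have "(\<lambda>s. l s - U (f s)) constant_on {q..b}"
    by (rule log_difference_constant)
      (use l ord up2 nz in \<open>auto intro!: cU continuous_on_subset[OF l(1)] simp: eU\<close>)
  then have 3: "l q - U (f q) = l b - U (f b)"
    using ord unfolding constant_on_def by fastforce
  have fab: "f a = f b" using l(2)[of a] l(2)[of b] l(3) ord by auto
  have "Im (f p) = 0" "Im (f q) = 0"
    using up1[of p] low[of p] low[of q] up2[of q] ord by auto
  then have fp: "f p = of_real (Re (f p))" and fq: "f q = - of_real (- Re (f q))"
    by (auto simp: complex_eq_iff)
  have Ln_i: "Ln (\<i> * of_real x) = ln x + \<i> * pi / 2" "Ln (- (\<i> * of_real x)) = ln x - \<i> * pi / 2"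
    if "x > 0" for x :: real
    using that Ln_times_of_real[of x \<i>] Ln_times_of_real[of x "-\<i>"]
    by (simp_all add: mult.commute Ln_of_real)
  have "U (f p) = D (f p)"
    unfolding U_def D_def by (subst (1 2) fp) (use pos Ln_i in simp)
  moreover have "U (f q) = D (f q) + 2 * \<i> * pi"
    unfolding U_def D_def by (subst (1 2) fq) (use neg Ln_i[of "- Re (f q)"] in simp)
  ultimately have "2 * \<i> * complex_of_real pi = 0"
    using 1 2 3 fab l(3) by (simp add: algebra_simps)
  then show False by simp
qed

section \<open>Position of the rope and of the hoop\<close>

lemma continuous_on_sign_constant:
  fixes f :: "'a::topological_space \<Rightarrow> real"
  assumes "continuous_on S f" "connected S" "\<And>x. x \<in> S \<Longrightarrow> f x \<noteq> 0"
    and "a \<in> S" "0 < f a" "x \<in> S"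
  shows "0 < f x"
proof (rule ccontr)
  assume "\<not> 0 < f x"
  have "connected (f ` S)" by (intro connected_continuous_image assms)
  then have "0 \<in> f ` S"
    using assms \<open>\<not> 0 < f x\<close> by (meson connectedD_interval image_eqI not_less order_less_imp_le)
  then show False using assms(3) by auto
qed

lemma continuous_on_section:
  assumes "continuous_on (A \<times> B) (\<lambda>(t, s). f t s)" "t \<in> A"
  shows "continuous_on B (f t)"
proof -
  have "continuous_on B (\<lambda>s. (\<lambda>(t, s). f t s) (t, s))"
    by (rule continuous_on_compose2[OF assms(1) continuous_on_Pair[OF continuous_on_const continuous_on_id]])
      (use assms(2) in auto)
  then show ?thesis by simp
qed

lemma mem_rope_polygonD:
  assumes "p \<in> rope_polygon"
  shows "p $ 1 = 0" "p $ 2 \<in> {-1<..<1} \<Longrightarrow> p $ 3 = 2" "0 \<le> p $ 3"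
  using assms by (auto simp: rope_polygon_def in_segment)

lemma top_mem_rope_polygon:
  assumes "v \<in> {-1..1}"
  shows "vector [0, v, 2] \<in> rope_polygon"
proof -
  have "vector [0, v, 2] = (1 - (v + 1) / 2) *\<^sub>R (vector [0, -1, 2] :: real^3) + ((v + 1) / 2) *\<^sub>R vector [0, 1, 2]"
    by (simp add: vec_eq_iff forall_3 field_simps)
  moreover have "0 \<le> (v + 1) / 2" "(v + 1) / 2 \<le> 1" using assms by auto
  ultimately have "vector [0, v, 2] \<in> closed_segment (vector [0, -1, 2] :: real^3) (vector [0, 1, 2])"
    unfolding in_segment by blast
  then show ?thesis by (simp add: rope_polygon_def)
qed

text \<open>The plane \<open>y = v\<close> meets the polygon only in its top segment, so injectivity
  leaves a single parameter. The values 0 and -1/2 of \<open>v\<close> give the centres of the ring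
  and of the initial hoop.\<close>

lemma rope_polygon_crossing:
  fixes \<alpha> :: "real \<Rightarrow> real^3"
  assumes "continuous_on {0..1} \<alpha>" "inj_on \<alpha> {0..1}" "\<alpha> ` {0..1} = rope_polygon"
    and ends: "\<alpha> 0 = vector [0, -1, 0]" "\<alpha> 1 = vector [0, 1, 0]" and v: "v \<in> {-1<..<1}"
  obtains s where "s \<in> {0<..<1}" "\<alpha> s = vector [0, v, 2]"
    "\<And>u. u \<in> {0..<s} \<Longrightarrow> \<alpha> u $ 2 < v" "\<And>u. u \<in> {s<..1} \<Longrightarrow> v < \<alpha> u $ 2"
proof -
  have "vector [0, v, 2] \<in> \<alpha> ` {0..1}"
    using top_mem_rope_polygon[of v] v assms(3) by auto
  then obtain s where s: "s \<in> {0..1}" "\<alpha> s = vector [0, v, 2]" by auto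
  have eq: "u = s" if "u \<in> {0..1}" "\<alpha> u $ 2 = v" for u
  proof -
    have "\<alpha> u \<in> rope_polygon" using that(1) assms(3) by auto
    then have "\<alpha> u = vector [0, v, 2]"
      using mem_rope_polygonD[of "\<alpha> u"] that(2) v by (simp add: vec_eq_iff forall_3)
    then show ?thesis using s that(1) assms(2) by (metis inj_onD)
  qed
  then have ne: "\<alpha> u $ 2 \<noteq> v" if "u \<in> {0..1}" "u \<noteq> s" for u
    using that by blast
  have "s \<noteq> 0" "s \<noteq> 1" using s(2) ends v by (auto simp: vec_eq_iff forall_3)
  with s(1) have s01: "s \<in> {0<..<1}" by auto
  then have ne1: "v \<noteq> \<alpha> u $ 2" if "u \<in> {0..<s}" for u
    using that ne[of u] by auto
  from s01 have ne2: "\<alpha> u $ 2 \<noteq> v" if "u \<in> {s<..1}" for u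
    using that ne[of u] by auto
  have c: "continuous_on A (\<lambda>u. \<alpha> u $ 2)" if "A \<subseteq> {0..1}" for A
    by (intro continuous_intros continuous_on_subset[OF assms(1) that])
  have "0 < v - \<alpha> u $ 2" if "u \<in> {0..<s}" for u
    by (rule continuous_on_sign_constant[where f = "\<lambda>u. v - \<alpha> u $ 2" and S = "{0..<s}" and a = 0 and x = u])
      (use that s01 ne1 ends v in \<open>auto intro!: continuous_intros c\<close>)
  moreover have "0 < \<alpha> u $ 2 - v" if "u \<in> {s<..1}" for u
    by (rule continuous_on_sign_constant[where f = "\<lambda>u. \<alpha> u $ 2 - v" and S = "{s<..1}" and a = 1 and x = u])
      (use that s01 ne2 ends v in \<open>auto intro!: continuous_intros c\<close>)
  ultimately show thesis using that s01 s(2) by force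
qed

text \<open>The linear part is orthogonal, so centre and normal can be carried along with the
  hoop.\<close>

lemma circle_eq_isometry:
  fixes f :: "real^3 \<Rightarrow> real^3"
  assumes "\<forall>x y. dist (f x) (f y) = dist x y"
  shows "circle_eq r (f c) (f (c + u) - f c) (f q) = circle_eq r c u q" and "surj f"
    and "f c = (1 / 2) *\<^sub>R (f (c + w) + f (c - w))" and "norm (f (c + u) - f c) = norm u"
proof -
  define Q where "Q = (\<lambda>x. f x - f 0)"
  have "orthogonal_transformation Q"
    unfolding orthogonal_transformation_isometry using assms by (simp add: Q_def dist_norm)
  then have lin: "linear Q" and inn: "\<And>x y. Q x \<bullet> Q y = x \<bullet> y" and "surj Q"
    by (simp_all add: orthogonal_transformation_linear orthogonal_transformation_def orthogonal_transformation_surj)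
  have norm: "norm (Q x) = norm x" for x using inn by (simp add: norm_eq_sqrt_inner)
  have f: "f x = f 0 + Q x" for x by (simp add: Q_def)
  have d: "f x - f y = Q (x - y)" for x y
    by (simp add: Q_def linear_diff[OF lin, unfolded Q_def])
  show "circle_eq r (f c) (f (c + u) - f c) (f q) = circle_eq r c u q"
    unfolding circle_eq_def d by (simp add: inn norm)
  show "norm (f (c + u) - f c) = norm u" unfolding d by (simp add: norm)
  show "surj f" using \<open>surj Q\<close> f by (metis add_diff_cancel_left' surj_def diff_add_cancel add.commute)
  show "f c = (1 / 2) *\<^sub>R (f (c + w) + f (c - w))"
  proof -
    have "f (c + w) + f (c - w) = 2 *\<^sub>R (f 0 + Q c)"
      unfolding f[of "c + w"] f[of "c - w"]
      by (simp add: linear_add[OF lin] linear_diff[OF lin] scaleR_2)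
    then show ?thesis by (simp add: f[of c])
  qed
qed

lemma hoop_minus_iff: "p \<in> hoop_minus r \<longleftrightarrow> circle_eq r (vector [0, -1/2, 2]) (vector [0, 1, 0]) p = 0"
  by (auto simp: hoop_minus_def circle_eq_def complex_eq_iff power2_norm_3 inner_vec_def sum_3)

text \<open>Antipodal points go to points at distance \<open>2 * r\<close> on a circle of radius
  \<open>r\<close>, hence to antipodal ones; this locates the centre. The sign of
  \<open>n $ 2\<close> stays open, since the hoop may arrive turned over.\<close>

lemma hoop_plus_frame:
  fixes f :: "real^3 \<Rightarrow> real^3"
  assumes iso: "\<forall>x y. dist (f x) (f y) = dist x y" and im: "f ` hoop_minus r = hoop_plus r" and "0 < r"
    and c0: "c = vector [0, -1/2, 2]" and u: "u = vector [0, 1, 0]"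
    and n: "n = f (c + u) - f c"
  shows "f c = vector [0, 1/2, 2]" "n $ 1 = 0" "n $ 2 \<noteq> 0" "n $ 3 = 0"
proof -
  define w :: "real^3" where "w = vector [r, 0, 0]"
  have "c + w \<in> hoop_minus r" "c - w \<in> hoop_minus r"
    by (simp_all add: hoop_minus_def c0 w_def)
  then have "f (c + w) \<in> hoop_plus r" "f (c - w) \<in> hoop_plus r" using im by auto
  then obtain X Y where XY: "X = f (c + w)" "Y = f (c - w)" "X $ 2 = 1/2" "Y $ 2 = 1/2"
    "(X $ 1)\<^sup>2 + (X $ 3 - 2)\<^sup>2 = r\<^sup>2" "(Y $ 1)\<^sup>2 + (Y $ 3 - 2)\<^sup>2 = r\<^sup>2"
    by (auto simp: hoop_plus_def)
  have "dist X Y = dist (c + w) (c - w)" using XY(1,2) iso by simp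
  then have "(norm (X - Y))\<^sup>2 = (norm (2 *\<^sub>R w))\<^sup>2"
    by (simp add: dist_norm scaleR_2)
  then have "(X $ 1 - Y $ 1)\<^sup>2 + (X $ 3 - Y $ 3)\<^sup>2 = 4 * r\<^sup>2"
    using XY(3,4) by (simp add: power2_norm_3 w_def)
  \<comment> \<open>The parallelogram law relative to the centre of the target hoop.\<close>
  then have "(X $ 1 + Y $ 1)\<^sup>2 + (X $ 3 + Y $ 3 - 4)\<^sup>2 = 0"
    using XY(5,6) by (simp add: power2_eq_square algebra_simps)
  then have "X $ 1 + Y $ 1 = 0" "X $ 3 + Y $ 3 = 4" by (simp_all add: sum_power2_eq_zero_iff)
  moreover have "f c = (1 / 2) *\<^sub>R (X + Y)"
    using circle_eq_isometry(3)[OF iso, of c w] XY by simp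
  ultimately show fc: "f c = vector [0, 1/2, 2]"
    using XY(3,4) by (simp add: vec_eq_iff forall_3)
  have orth: "n \<bullet> (p - f c) = 0" if p: "p \<in> hoop_plus r" for p
  proof -
    obtain q where q: "q \<in> hoop_minus r" "p = f q" using im p by auto
    then have "circle_eq r (f c) n p = 0"
      using circle_eq_isometry(1)[OF iso, of r c u q] n c0 u hoop_minus_iff[of q r] by simp
    then show ?thesis by (simp add: circle_eq_def complex_eq_iff)
  qed
  have "vector [r, 1/2, 2] \<in> hoop_plus r" "vector [0, 1/2, 2 + r] \<in> hoop_plus r"
    by (simp_all add: hoop_plus_def)
  from this[THEN orth] show n13: "n $ 1 = 0" "n $ 3 = 0"
    using \<open>0 < r\<close> by (simp_all add: fc inner_vec_def sum_3)
  have "(norm n)\<^sup>2 = 1"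
    unfolding n circle_eq_isometry(4)[OF iso] u by (simp add: power2_norm_3)
  then show "n $ 2 \<noteq> 0" using n13 by (auto simp: power2_norm_3)
qed

section \<open>Switching off crossings on one sheet\<close>

text \<open>On the non-positive real axis the weight is 1 for \<open>c > 0\<close> and 0 for \<open>c < 0\<close>, since
\<open>cmod F + Re F\<close> vanishes exactly there. Blending \<open>F\<close> with 1 thus keeps the crossings of that axis
where \<open>c > 0\<close> and removes the others.\<close>

definition blend_weight :: "complex \<Rightarrow> real \<Rightarrow> real" where
  "blend_weight F c = (1 + c / (\<bar>c\<bar> + (cmod F + Re F))) / 2"

definition blend :: "complex \<Rightarrow> real \<Rightarrow> complex" where
  "blend F c = of_real (blend_weight F c) * F + of_real (1 - blend_weight F c)"

lemma nonpos_Reals_iff_cmod: "F \<in> \<real>\<^sub>\<le>\<^sub>0 \<longleftrightarrow> cmod F + Re F = 0"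
proof
  assume "F \<in> \<real>\<^sub>\<le>\<^sub>0"
  then show "cmod F + Re F = 0" by (simp add: complex_nonpos_Reals_iff cmod_eq_Re)
next
  assume "cmod F + Re F = 0"
  then have "cmod F = - Re F" by simp
  then have "(Re F)\<^sup>2 + (Im F)\<^sup>2 = (Re F)\<^sup>2" "Re F \<le> 0"
    using cmod_power2[of F] norm_ge_zero[of F] by auto
  then show "F \<in> \<real>\<^sub>\<le>\<^sub>0" by (simp add: complex_nonpos_Reals_iff)
qed

lemma blend_weight_bounds: "0 \<le> blend_weight F c" "blend_weight F c \<le> 1"
proof -
  have "0 \<le> cmod F + Re F" using abs_Re_le_cmod[of F] by linarith
  define x where "x = c / (\<bar>c\<bar> + (cmod F + Re F))"
  have "\<bar>x\<bar> \<le> 1"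
    unfolding x_def using \<open>0 \<le> cmod F + Re F\<close>
    by (cases "\<bar>c\<bar> + (cmod F + Re F) = 0") (auto simp: abs_divide divide_le_eq_1)
  then show "0 \<le> blend_weight F c" "blend_weight F c \<le> 1"
    unfolding blend_weight_def x_def[symmetric] by (simp_all add: abs_le_iff)
qed

lemma blend_nonpos:
  assumes "F \<in> \<real>\<^sub>\<le>\<^sub>0"
  shows "0 < c \<Longrightarrow> blend F c = F" "c < 0 \<Longrightarrow> blend F c = 1"
  using assms by (simp_all add: blend_def blend_weight_def nonpos_Reals_iff_cmod)

lemma blend_1 [simp]: "blend 1 c = 1"
  by (simp add: blend_def)

text \<open>Ensures that blending with 1 creates no new crossing of the non-positive axis.\<close>

lemma slit_plane_starlike:
  fixes F :: complex
  assumes "F \<notin> \<real>\<^sub>\<le>\<^sub>0" "0 \<le> a" "a \<le> 1"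
  shows "of_real a * F + of_real (1 - a) \<notin> \<real>\<^sub>\<le>\<^sub>0"
proof (cases "Im F = 0 \<or> a = 0")
  case True
  then have "0 < a * Re F + (1 - a)"
    using assms by (cases "a = 0") (auto simp: complex_nonpos_Reals_iff intro: add_pos_nonneg)
  then show ?thesis by (simp add: complex_nonpos_Reals_iff)
next
  case False
  then show ?thesis by (simp add: complex_nonpos_Reals_iff)
qed

text \<open>The denominator of the weight vanishes only where \<open>F\<close> meets the
  non-positive axis and \<open>c = 0\<close>, which the last assumption excludes.\<close>

lemma continuous_on_blend [continuous_intros]:
  assumes "continuous_on S F" "continuous_on S c" "\<And>x. x \<in> S \<Longrightarrow> F x \<in> \<real>\<^sub>\<le>\<^sub>0 \<Longrightarrow> c x \<noteq> 0"
  shows "continuous_on S (\<lambda>x. blend (F x) (c x))"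
proof -
  have "\<bar>c x\<bar> + (cmod (F x) + Re (F x)) \<noteq> 0" if "x \<in> S" for x
    using assms(3)[OF that] abs_Re_le_cmod[of "F x"] unfolding nonpos_Reals_iff_cmod by fastforce
  then show ?thesis
    unfolding blend_def blend_weight_def by (intro continuous_intros assms) auto
qed

section \<open>The rope closed up along the table and the pole\<close>

text \<open>The parameter runs over \<open>[-2, 3]\<close>: pole, table, rope on \<open>[0, 1]\<close>, table, pole.\<close>

definition extended_rope :: "(real \<Rightarrow> real^3) \<Rightarrow> real \<Rightarrow> real^3" where
  "extended_rope \<alpha> s = \<alpha> (max 0 (min 1 s))
     + (min 1 (max 0 (- s)) - min 1 (max 0 (s - 1))) *\<^sub>R axis 2 1
     + (max 0 (- 1 - s) + max 0 (s - 2)) *\<^sub>R axis 3 1"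

lemma extended_rope_simps:
  assumes "\<alpha> 0 = vector [0, -1, 0]" "\<alpha> 1 = vector [0, 1, 0]"
  shows "s \<in> {-2..-1} \<Longrightarrow> extended_rope \<alpha> s = vector [0, 0, - 1 - s]"
    "s \<in> {-1..0} \<Longrightarrow> extended_rope \<alpha> s = vector [0, - 1 - s, 0]"
    "s \<in> {0..1} \<Longrightarrow> extended_rope \<alpha> s = \<alpha> s"
    "s \<in> {1..2} \<Longrightarrow> extended_rope \<alpha> s = vector [0, 2 - s, 0]"
    "s \<in> {2..3} \<Longrightarrow> extended_rope \<alpha> s = vector [0, 0, s - 2]"
  using assms
  by (simp_all add: extended_rope_def vec_eq_iff forall_3 axis_def max_absorb1 max_absorb2
      min_absorb1 min_absorb2)

lemma extended_rope_cases:
  assumes ends: "\<alpha> 0 = vector [0, -1, 0]" "\<alpha> 1 = vector [0, 1, 0]" and s: "s \<in> {-2..3}"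
  obtains (pole) z where "s \<in> {-2..-1} \<union> {2..3}" "z \<in> {0..1}" "extended_rope \<alpha> s = vector [0, 0, z]"
  | (table) y where "s \<in> {-1..0} \<union> {1..2}" "extended_rope \<alpha> s = vector [0, y, 0]"
  | (rope) "s \<in> {0..1}" "extended_rope \<alpha> s = \<alpha> s"
proof -
  consider "s \<in> {-2..-1}" | "s \<in> {-1..0}" | "s \<in> {0..1}" | "s \<in> {1..2}" | "s \<in> {2..3}"
    using s by force
  then show thesis
    by cases (use extended_rope_simps[OF ends, of s] pole[of "-1-s"] pole[of "s-2"] table rope in auto)
qed

lemma continuous_on_extended_rope:
  assumes "continuous_on ({0..1} \<times> {0..1}) (\<lambda>(t, s). \<gamma> t s)"
  shows "continuous_on ({0..1} \<times> UNIV) (\<lambda>(t, s). extended_rope (\<gamma> t) s)"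
proof -
  have "continuous_on ({0..1} \<times> UNIV) (\<lambda>x. (\<lambda>(t, s). \<gamma> t s) (fst x, max 0 (min 1 (snd x))))"
    by (rule continuous_on_compose2[OF assms]) (auto intro!: continuous_intros)
  then show ?thesis
    unfolding extended_rope_def case_prod_unfold by (intro continuous_intros) simp_all
qed

lemma ring_eq_zero_imp_pole: "ring_eq p = 0 \<Longrightarrow> p \<in> pole"
  by (auto simp: ring_eq_def pole_def complex_eq_iff)

lemma extended_rope_sign:
  assumes ends: "\<alpha> 0 = vector [0, -1, 0]" "\<alpha> 1 = vector [0, 1, 0]"
    and m: "m \<in> {0<..<1}" "\<alpha> m = vector [0, 0, 2]"
    and before: "\<And>u. u \<in> {0..<m} \<Longrightarrow> \<alpha> u $ 2 < 0" and after: "\<And>u. u \<in> {m<..1} \<Longrightarrow> 0 < \<alpha> u $ 2"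
    and s: "s \<in> {-2..3}"
  shows "extended_rope \<alpha> s $ 2 < 0 \<longleftrightarrow> s \<in> {-1<..<m}" "0 < extended_rope \<alpha> s $ 2 \<longleftrightarrow> s \<in> {m<..<2}"
proof -
  consider "s \<in> {-2..-1}" | "s \<in> {-1..0}" | "s \<in> {0..<m}" | "s = m" | "s \<in> {m<..1}" | "s \<in> {1..2}" | "s \<in> {2..3}"
    using s by force
  then have "(extended_rope \<alpha> s $ 2 < 0 \<longleftrightarrow> s \<in> {-1<..<m}) \<and> (0 < extended_rope \<alpha> s $ 2 \<longleftrightarrow> s \<in> {m<..<2})"
  proof cases
    case 3
    then show ?thesis using before[of s] extended_rope_simps(3)[OF ends, of s] m by auto
  next
    case 5
    then show ?thesis using after[of s] extended_rope_simps(3)[OF ends, of s] m by auto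
  qed (use extended_rope_simps[OF ends, of s] m in \<open>auto\<close>)
  then show "extended_rope \<alpha> s $ 2 < 0 \<longleftrightarrow> s \<in> {-1<..<m}" "0 < extended_rope \<alpha> s $ 2 \<longleftrightarrow> s \<in> {m<..<2}"
    by auto
qed

text \<open>The imaginary part of the square gives Re * Im = -y, so signs can change only where
  \<open>y = 0\<close>; at \<open>m\<close> the square is -1, so Im survives. Passing through the
  ring thus takes \<open>\<sigma>\<close> from the first to the second quadrant, to the other
  sheet.\<close>

lemma ring_eq_sqrt_quadrants:
  fixes \<sigma> :: "real \<Rightarrow> complex"
  assumes ends: "\<alpha> 0 = vector [0, -1, 0]" "\<alpha> 1 = vector [0, 1, 0]"
    and m: "m \<in> {0<..<1}" "\<alpha> m = vector [0, 0, 2]"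
    and before: "\<And>u. u \<in> {0..<m} \<Longrightarrow> \<alpha> u $ 2 < 0" and after: "\<And>u. u \<in> {m<..1} \<Longrightarrow> 0 < \<alpha> u $ 2"
    and cont: "continuous_on {-1..2} \<sigma>" and start: "0 < Re (\<sigma> (-1))"
    and sq: "\<And>s. s \<in> {-1..2} \<Longrightarrow> (\<sigma> s)\<^sup>2 = - ring_eq (extended_rope \<alpha> s)"
  shows "s \<in> {-1<..<2} \<Longrightarrow> 0 < Im (\<sigma> s)" "s \<in> {-1<..<m} \<Longrightarrow> 0 < Re (\<sigma> s)" "s \<in> {m<..<2} \<Longrightarrow> Re (\<sigma> s) < 0"
proof -
  note sign = extended_rope_sign[OF ends m before after]
  have prod: "Re (\<sigma> s) * Im (\<sigma> s) = - (extended_rope \<alpha> s $ 2)" if "s \<in> {-1..2}" for s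
    using arg_cong[OF sq[OF that], of Im] by (simp add: ring_eq_def power2_eq_square mult.commute)
  have re: "continuous_on A (\<lambda>s. Re (\<sigma> s))" and im: "continuous_on A (\<lambda>s. Im (\<sigma> s))" if "A \<subseteq> {-1..2}" for A
    by (intro continuous_intros continuous_on_subset[OF cont that])+
  have re_pos: "0 < Re (\<sigma> s)" if "s \<in> {-1..<m}" for s
  proof (rule continuous_on_sign_constant[where f = "\<lambda>s. Re (\<sigma> s)" and S = "{-1..<m}" and a = "-1" and x = s])
    show "Re (\<sigma> u) \<noteq> 0" if u: "u \<in> {-1..<m}" for u
    proof (cases "u = -1")
      case False
      then have "extended_rope \<alpha> u $ 2 < 0" using sign(1)[of u] u m(1) by auto
      then show ?thesis using prod[of u] u m(1) by auto
    qed (use start in auto)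
  qed (use m that start in \<open>auto intro!: re\<close>)
  then show "s \<in> {-1<..<m} \<Longrightarrow> 0 < Re (\<sigma> s)" by auto
  have im_pos: "0 < Im (\<sigma> s)" if "s \<in> {-1<..<2}" for s
  proof (rule continuous_on_sign_constant[where f = "\<lambda>s. Im (\<sigma> s)" and S = "{-1<..<2}" and a = 0 and x = s])
    show "Im (\<sigma> u) \<noteq> 0" if u: "u \<in> {-1<..<2}" for u
    proof
      assume 0: "Im (\<sigma> u) = 0"
      then have "extended_rope \<alpha> u $ 2 = 0" using prod[of u] u by auto
      then have "u = m" using sign[of u] u m(1) by (auto simp: not_less antisym_conv3)
      then have "(\<sigma> u)\<^sup>2 = -1"
        using sq[of u] u m extended_rope_simps(3)[OF ends, of m]
        by (simp add: ring_eq_def complex_eq_iff)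
      then have "Re ((\<sigma> u)\<^sup>2) = -1" by simp
      then have "(Re (\<sigma> u))\<^sup>2 = -1" using 0 by (simp add: power2_eq_square)
      then show False using zero_le_power2[of "Re (\<sigma> u)"] by linarith
    qed
    have "Re (\<sigma> 0) * Im (\<sigma> 0) = 1"
      using prod[of 0] extended_rope_simps(3)[OF ends, of 0] ends by simp
    then show "0 < Im (\<sigma> 0)"
      using re_pos[of 0] m(1) zero_less_mult_iff[of "Re (\<sigma> 0)" "Im (\<sigma> 0)"] by auto
  qed (use that in \<open>auto intro!: im\<close>)
  then show "s \<in> {-1<..<2} \<Longrightarrow> 0 < Im (\<sigma> s)" by auto
  show "Re (\<sigma> s) < 0" if "s \<in> {m<..<2}"
  proof -
    have "Re (\<sigma> s) * Im (\<sigma> s) < 0" using prod[of s] sign(2)[of s] that m(1) by auto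
    then show ?thesis using im_pos[of s] that m(1) by (auto simp: mult_less_0_iff)
  qed
qed

lemma csqrt_right_half_plane:
  assumes "z \<notin> \<real>\<^sub>\<le>\<^sub>0"
  shows "0 < Re (csqrt z)" "Re (csqrt z) * Im (csqrt z) = Im z / 2"
proof -
  have "Re (csqrt z) \<noteq> 0"
  proof
    assume 0: "Re (csqrt z) = 0"
    have "(csqrt z)\<^sup>2 = z" by simp
    then have "Re z = - (Im (csqrt z))\<^sup>2" "Im z = 0"
      using 0 by (auto simp: complex_eq_iff power2_eq_square simp del: csqrt.sel power2_csqrt)
    then have "Re z \<le> 0" "Im z = 0" using zero_le_power2[of "Im (csqrt z)"] by linarith+
    then show False using assms unfolding complex_nonpos_Reals_iff by blast
  qed
  then show "0 < Re (csqrt z)" using csqrt_principal[of z] by auto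
  have "(csqrt z)\<^sup>2 = z" by simp
  from arg_cong[OF this, of Im] show "Re (csqrt z) * Im (csqrt z) = Im z / 2"
    by (simp add: power2_eq_square ac_simps del: csqrt.sel power2_csqrt)
qed

section \<open>The invariant crossing number\<close>

text \<open>The hoop is recorded by centre and normal, as the zero set of \<open>circle_eq\<close>.
  The final normal is fixed only up to a nonzero factor.\<close>

locale hoop_motion =
  fixes r :: real and c n :: "real \<Rightarrow> real^3" and \<gamma> :: "real \<Rightarrow> real \<Rightarrow> real^3"
  assumes r: "1 \<le> r" "r < 2"
    and cont_c: "continuous_on {0..1} c" and cont_n: "continuous_on {0..1} n"
    and cont_rope: "continuous_on ({0..1} \<times> {0..1}) (\<lambda>(t, s). \<gamma> t s)"
    and initial: "c 0 = vector [0, -1/2, 2]" "n 0 = vector [0, 1, 0]"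
    and final: "c 1 = vector [0, 1/2, 2]" "n 1 $ 1 = 0" "n 1 $ 2 \<noteq> 0" "n 1 $ 3 = 0"
    and polygon: "\<And>t. t \<in> {0, 1} \<Longrightarrow> inj_on (\<gamma> t) {0..1}" "\<And>t. t \<in> {0, 1} \<Longrightarrow> \<gamma> t ` {0..1} = rope_polygon"
    and ends: "\<And>t. t \<in> {0..1} \<Longrightarrow> \<gamma> t 0 = vector [0, -1, 0]" "\<And>t. t \<in> {0..1} \<Longrightarrow> \<gamma> t 1 = vector [0, 1, 0]"
    and rope_pole: "\<And>t s. t \<in> {0..1} \<Longrightarrow> s \<in> {0..1} \<Longrightarrow> \<gamma> t s \<notin> pole"
    and hoop: "\<And>t p. t \<in> {0..1} \<Longrightarrow> circle_eq r (c t) (n t) p = 0 \<Longrightarrow> 0 < p $ 3 \<and> p \<notin> pole \<and> p \<notin> \<gamma> t ` {0..1}"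
begin

abbreviation K :: "real \<Rightarrow> real \<Rightarrow> real^3" where
  "K t \<equiv> extended_rope (\<gamma> t)"

text \<open>Normalised to be 1 at P: real values mark the sphere through the hoop and P, negative
  ones its cap on the far side of the hoop.\<close>

definition F :: "real \<Rightarrow> real \<Rightarrow> complex" where
  "F t s = circle_eq r (c t) (n t) (K t s) / circle_eq r (c t) (n t) (vector [0, 0, 1])"

lemma unlinked:
  assumes t: "t \<in> {0..1}" and "x\<^sup>2 + z\<^sup>2 \<le> 1"
  shows "disc_trace r (c t) (n t) x z \<noteq> 0"
proof -
  have "disc_trace r (c t) (n t) 0 0 + of_real x * Complex (- 2 * c t $ 1) (n t $ 1)
      + of_real z * Complex (- 2 * (c t $ 3 - 2)) (n t $ 3) \<noteq> 0"
  proof (rule affine_family_nonzero_on_disc[OF _ _ _ _ _ assms])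
    show "continuous_on {0..1} (\<lambda>t. disc_trace r (c t) (n t) 0 0)"
      unfolding disc_trace_def circle_eq_def by (intro continuous_intros cont_c cont_n)
    show "continuous_on {0..1} (\<lambda>t. Complex (- 2 * c t $ 1) (n t $ 1))"
      "continuous_on {0..1} (\<lambda>t. Complex (- 2 * (c t $ 3 - 2)) (n t $ 3))"
      by (intro continuous_intros cont_c cont_n)+
  next
    fix t x z :: real assume t: "t \<in> {0..1}" and xz: "x\<^sup>2 + z\<^sup>2 = 1"
    have "vector [x, 0, 2 + z] \<in> pole"
      using xz by (simp add: pole_def)
    then have "circle_eq r (c t) (n t) (vector [x, 0, 2 + z]) \<noteq> 0" using hoop[OF t] by blast
    moreover have "disc_trace r (c t) (n t) x z = circle_eq r (c t) (n t) (vector [x, 0, 2 + z])"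
    proof -
      have "1 - x\<^sup>2 - z\<^sup>2 = 0" using xz by simp
      then show ?thesis by (simp only: disc_trace_def of_real_0 add_0_right)
    qed
    ultimately show "disc_trace r (c t) (n t) 0 0 + of_real x * Complex (- 2 * c t $ 1) (n t $ 1)
      + of_real z * Complex (- 2 * (c t $ 3 - 2)) (n t $ 3) \<noteq> 0"
      unfolding disc_trace_affine[symmetric] by simp
  next
    fix x z :: real
    \<comment> \<open>The initial hoop lies in the plane \<open>y = -1/2\<close>, at constant
      distance from the disc of the ring.\<close>
    have "Im (disc_trace r (c 0) (n 0) x z) = 1 / 2"
      by (simp add: disc_trace_def circle_eq_def initial inner_vec_def sum_3)
    then show "disc_trace r (c 0) (n 0) 0 0 + of_real x * Complex (- 2 * c 0 $ 1) (n 0 $ 1)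
      + of_real z * Complex (- 2 * (c 0 $ 3 - 2)) (n 0 $ 3) \<noteq> 0"
      unfolding disc_trace_affine[symmetric] by auto
  qed
  then show ?thesis unfolding disc_trace_affine[symmetric] .
qed

lemma apex_not_on_hoop: "t \<in> {0..1} \<Longrightarrow> circle_eq r (c t) (n t) (vector [0, 0, 1]) \<noteq> 0"
  using hoop[of t "vector [0, 0, 1]"] by (auto simp: pole_def)

text \<open>The table pieces are safe because the hoop stays at positive height; the other pieces
  are avoided by assumption.\<close>

lemma K_not_on_hoop:
  assumes t: "t \<in> {0..1}" and s: "s \<in> {-2..3}"
  shows "circle_eq r (c t) (n t) (K t s) \<noteq> 0"
proof
  assume 0: "circle_eq r (c t) (n t) (K t s) = 0"
  from s show False
    by (cases rule: extended_rope_cases[OF ends[OF t]])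
      (use hoop[OF t 0] in \<open>auto simp: pole_def\<close>)
qed

text \<open>The range \<open>[-1, 2]\<close> leaves out the pole pieces, which end at the zero P of
  \<open>ring_eq\<close>. On the table the real part is at most -3.\<close>

lemma ring_eq_K_nonzero:
  assumes t: "t \<in> {0..1}" and s: "s \<in> {-1..2}"
  shows "ring_eq (K t s) \<noteq> 0"
proof -
  consider "s \<in> {-1..0}" | "s \<in> {0..1}" | "s \<in> {1..2}" using s by force
  then show ?thesis
  proof cases
    case 2
    then show ?thesis using extended_rope_simps(3)[OF ends[OF t] 2] rope_pole[OF t 2] ring_eq_zero_imp_pole by auto
  next
    case 1
    then have "Re (ring_eq (K t s)) = - 3 - (-1 - s)\<^sup>2"
      using extended_rope_simps(2)[OF ends[OF t] 1] by (simp add: ring_eq_def)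
    then have "Re (ring_eq (K t s)) < 0" using zero_le_power2[of "-1 - s"] by linarith
    then show ?thesis by auto
  next
    case 3
    then have "Re (ring_eq (K t s)) = - 3 - (2 - s)\<^sup>2"
      using extended_rope_simps(4)[OF ends[OF t] 3] by (simp add: ring_eq_def)
    then have "Re (ring_eq (K t s)) < 0" using zero_le_power2[of "2 - s"] by linarith
    then show ?thesis by auto
  qed
qed

lemma continuous_on_K [continuous_intros]:
  assumes "continuous_on S f" "continuous_on S g" "\<And>x. x \<in> S \<Longrightarrow> f x \<in> {0..1}"
  shows "continuous_on S (\<lambda>x. K (f x) (g x))"
proof -
  have "continuous_on S (\<lambda>x. (\<lambda>(t, s). K t s) (f x, g x))"
    by (rule continuous_on_compose2[OF continuous_on_extended_rope[OF cont_rope]])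
      (use assms in \<open>auto intro!: continuous_intros\<close>)
  then show ?thesis by simp
qed

lemma continuous_on_F [continuous_intros]:
  assumes "continuous_on S f" "continuous_on S g" "\<And>x. x \<in> S \<Longrightarrow> f x \<in> {0..1}"
  shows "continuous_on S (\<lambda>x. F (f x) (g x))"
proof -
  have "continuous_on S (\<lambda>x. c (f x))" "continuous_on S (\<lambda>x. n (f x))"
    by (rule continuous_on_compose2[OF cont_c] continuous_on_compose2[OF cont_n]; use assms in auto)+
  then have circ: "continuous_on S (\<lambda>x. circle_eq r (c (f x)) (n (f x)) (h x))" if "continuous_on S h" for h
    unfolding circle_eq_def using that by (intro continuous_intros)
  show ?thesis
    unfolding F_def using assms apex_not_on_hoop
    by (intro continuous_on_divide circ continuous_on_const continuous_on_K) auto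
qed

lemma F_nonzero: "t \<in> {0..1} \<Longrightarrow> s \<in> {-2..3} \<Longrightarrow> F t s \<noteq> 0"
  using K_not_on_hoop apex_not_on_hoop by (simp add: F_def)

lemma F_ends:
  assumes "t \<in> {0..1}"
  shows "F t (-2) = 1" "F t 3 = 1"
  using extended_rope_simps(1,5)[OF ends[OF assms]] apex_not_on_hoop[OF assms] by (simp_all add: F_def)

lemma K_cap:
  assumes "t \<in> {0..1}" and "F t s \<in> \<real>\<^sub>\<le>\<^sub>0"
  obtains a where "0 \<le> a"
    "circle_eq r (c t) (n t) (K t s) = - of_real a * circle_eq r (c t) (n t) (vector [0, 0, 1])"
proof -
  obtain a where "F t s = of_real a" "a \<le> 0" using assms(2) by (auto elim: nonpos_Reals_cases)
  then show thesis using apex_not_on_hoop[OF assms(1)] by (intro that[of "- a"]) (auto simp: F_def field_simps)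
qed

lemma mean_ring_eq_slit: "t \<in> {0..1} \<Longrightarrow> - mean_ring_eq r (c t) \<notin> \<real>\<^sub>\<le>\<^sub>0"
  using mean_ring_eq_notin_nonneg_Reals[OF r(1) unlinked, of t] by simp

text \<open>The cap lies beyond the plane of the hoop as seen from P, so comparing imaginary parts
  is enough.\<close>

lemma initial_cap: "F 0 s \<in> \<real>\<^sub>\<le>\<^sub>0 \<Longrightarrow> K 0 s $ 2 < 0"
proof (erule K_cap[rotated])
  fix a assume "0 \<le> a" and
    "circle_eq r (c 0) (n 0) (K 0 s) = - of_real a * circle_eq r (c 0) (n 0) (vector [0, 0, 1])"
  from arg_cong[OF this(2), of Im] have "K 0 s $ 2 + 1 / 2 = - a * (1 / 2)"
    by (simp add: circle_eq_def initial inner_vec_def sum_3)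
  with \<open>0 \<le> a\<close> show ?thesis by simp
qed simp

text \<open>As for \<open>initial_cap\<close>; the undetermined factor \<open>n 1 $ 2\<close>
  cancels.\<close>

lemma final_cap: "F 1 s \<in> \<real>\<^sub>\<le>\<^sub>0 \<Longrightarrow> 0 < K 1 s $ 2"
proof (erule K_cap[rotated])
  fix a assume "0 \<le> a" and
    "circle_eq r (c 1) (n 1) (K 1 s) = - of_real a * circle_eq r (c 1) (n 1) (vector [0, 0, 1])"
  from arg_cong[OF this(2), of Im] have "n 1 $ 2 * (K 1 s $ 2 - 1 / 2) = n 1 $ 2 * (a * (1 / 2))"
    by (simp add: circle_eq_def final inner_vec_def sum_3)
  then have "K 1 s $ 2 - 1 / 2 = a * (1 / 2)" using final(3) by simp
  with \<open>0 \<le> a\<close> show ?thesis by simp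
qed simp

lemma ring_eq_K_at_origin:
  assumes "t \<in> {0..1}"
  shows "ring_eq (K t (-1)) = -3" "ring_eq (K t 2) = -3"
  using extended_rope_simps(1)[OF ends[OF assms], of "-1"] extended_rope_simps(5)[OF ends[OF assms], of 2]
  by (simp_all add: ring_eq_def complex_eq_iff)

text \<open>At \<open>s = -1\<close> the square is 3, so the root has a nonzero real part whose sign
  is constant in time; one global sign \<open>e\<close> normalises it.\<close>

lemma obtain_ring_sqrt:
  obtains \<sigma> :: "real \<Rightarrow> real \<Rightarrow> complex"
  where "continuous_on ({0..1} \<times> {-1..2}) (\<lambda>(t, s). \<sigma> t s)"
    and "\<And>t s. t \<in> {0..1} \<Longrightarrow> s \<in> {-1..2} \<Longrightarrow> (\<sigma> t s)\<^sup>2 = - ring_eq (K t s)"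
    and "\<And>t. t \<in> {0..1} \<Longrightarrow> 0 < Re (\<sigma> t (-1))"
proof -
  have c: "continuous_on ({0..1} \<times> {-1..2}) (\<lambda>x. - ring_eq (K (fst x) (snd x)))"
    unfolding ring_eq_def by (intro continuous_intros) auto
  have "contractible ({0..1::real} \<times> {-1..2::real})"
    by (intro convex_imp_contractible convex_Times) auto
  from continuous_sqrt_on_contractible[OF c this]
  obtain q where q: "continuous_on ({0..1} \<times> {-1..2}) q"
    "\<And>x. x \<in> {0..1} \<times> {-1..2} \<Longrightarrow> - ring_eq (K (fst x) (snd x)) = (q x)\<^sup>2"
    using ring_eq_K_nonzero by (metis (no_types, lifting) SigmaE fst_conv neg_equal_0_iff_equal snd_conv)
  have cq: "continuous_on {0..1} (\<lambda>t. Re (q (t, -1)))"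
    by (intro continuous_intros continuous_on_compose2[OF q(1)]) auto
  have nz: "Re (q (t, -1)) \<noteq> 0" if t: "t \<in> {0..1}" for t
  proof
    assume "Re (q (t, -1)) = 0"
    moreover have "(q (t, -1))\<^sup>2 = 3" using q(2)[of "(t, -1)"] ring_eq_K_at_origin(1)[OF t] t by simp
    moreover from this have "(Re (q (t, -1)))\<^sup>2 - (Im (q (t, -1)))\<^sup>2 = 3"
      by (simp flip: Re_power2)
    ultimately have "- (Im (q (t, -1)))\<^sup>2 = 3" by simp
    then show False using zero_le_power2[of "Im (q (t, -1))"] by linarith
  qed
  define e where "e = sgn (Re (q (0, -1)))"
  have e: "e\<^sup>2 = 1" "0 < e * Re (q (0, -1))"
    using nz[of 0] by (auto simp: e_def sgn_if)
  show thesis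
  proof (rule that[of "\<lambda>t s. of_real e * q (t, s)"])
    show "continuous_on ({0..1} \<times> {-1..2}) (\<lambda>(t, s). of_real e * q (t, s))"
      using q(1) by (auto simp: case_prod_unfold intro!: continuous_intros)
    show "(of_real e * q (t, s))\<^sup>2 = - ring_eq (K t s)" if "t \<in> {0..1}" "s \<in> {-1..2}" for t s
      using q(2)[of "(t, s)"] that e(1) by (simp add: power_mult_distrib flip: of_real_power)
    show "0 < Re (of_real e * q (t, -1))" if "t \<in> {0..1}" for t
      by (rule continuous_on_sign_constant[where f = "\<lambda>t. Re (of_real e * q (t, -1))" and S = "{0..1}" and a = 0 and x = t])
        (use that e nz in \<open>auto intro!: continuous_intros cq[simplified]\<close>)
  qed
qed

text \<open>The closed rope crosses the plane of the initial hoop twice: on the table, outside the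
  hoop because \<open>r < 2\<close>, and at the centre of the hoop.\<close>

lemma F_0_no_closed_log: "\<not> closed_log_on (-2) 3 (F 0)"
proof
  assume "closed_log_on (-2) 3 (F 0)"
  then have "closed_log_on (-2) 3 (\<lambda>s. circle_eq r (c 0) (n 0) (vector [0, 0, 1]) * F 0 s)"
    using apex_not_on_hoop[of 0] by (intro closed_log_on_mult_const) auto
  moreover have eq: "circle_eq r (c 0) (n 0) (vector [0, 0, 1]) * F 0 s = circle_eq r (c 0) (n 0) (K 0 s)" for s
    using apex_not_on_hoop[of 0] by (simp add: F_def)
  ultimately have cl: "closed_log_on (-2) 3 (\<lambda>s. circle_eq r (c 0) (n 0) (K 0 s))" by simp
  have ends0: "\<gamma> 0 0 = vector [0, -1, 0]" "\<gamma> 0 1 = vector [0, 1, 0]" by (simp_all add: ends)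
  have "continuous_on {0..1} (\<gamma> 0)"
    by (rule continuous_on_section[OF cont_rope]) simp
  from rope_polygon_crossing[OF this polygon ends0, of "-1/2"]
  obtain q where q: "q \<in> {0<..<1}" "\<gamma> 0 q = vector [0, - 1 / 2, 2]"
    "\<And>u. u \<in> {0..<q} \<Longrightarrow> \<gamma> 0 u $ 2 < - 1 / 2" "\<And>u. u \<in> {q<..1} \<Longrightarrow> - 1 / 2 < \<gamma> 0 u $ 2"
    by auto
  have Im: "Im (circle_eq r (c 0) (n 0) p) = p $ 2 + 1 / 2" for p
    by (simp add: circle_eq_def initial inner_vec_def sum_3)
  note K = extended_rope_simps[OF ends0]
  have r2: "r\<^sup>2 < 4" "0 < r\<^sup>2" using r abs_square_less_1[of "r / 2"] by (auto simp: power_divide)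
  have "\<not> closed_log_on (-2) 3 (\<lambda>s. circle_eq r (c 0) (n 0) (K 0 s))"
  proof (rule no_closed_log_on_one_turn[where p = "-1/2" and q = q])
    show "continuous_on {-2..3} (\<lambda>s. circle_eq r (c 0) (n 0) (K 0 s))"
      unfolding circle_eq_def by (intro continuous_intros) auto
    show "circle_eq r (c 0) (n 0) (K 0 s) \<noteq> 0" if "s \<in> {-2..3}" for s
      using that by (intro K_not_on_hoop) auto
    show "0 \<le> Im (circle_eq r (c 0) (n 0) (K 0 s))" if "s \<in> {-2..-1/2}" for s
      using that K(1,2)[of s] unfolding Im by (cases "s \<le> -1") auto
    show "Im (circle_eq r (c 0) (n 0) (K 0 s)) \<le> 0" if "s \<in> {-1/2..q}" for s
    proof (cases "s \<le> 0")
      case False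
      then have "K 0 s = \<gamma> 0 s" using that K(3)[of s] q(1) by auto
      then show ?thesis
        unfolding Im using that False q(2) q(3)[of s] by (cases "s = q") auto
    qed (use that K(2)[of s] q in \<open>auto simp: Im\<close>)
    show "0 \<le> Im (circle_eq r (c 0) (n 0) (K 0 s))" if s: "s \<in> {q..3}" for s
    proof -
      consider "s = q" | "s \<in> {q<..1}" | "s \<in> {1..2}" | "s \<in> {2..3}" using s q(1) by force
      then show ?thesis
        by cases (use K[of s] q(1,2) q(4)[of s] in \<open>auto simp: Im\<close>)
    qed
    show "0 < Re (circle_eq r (c 0) (n 0) (K 0 (-1/2)))"
      using K(2)[of "-1/2"] r2 by (simp add: circle_eq_def initial power2_norm_3)
    show "Re (circle_eq r (c 0) (n 0) (K 0 q)) < 0"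
      using K(3)[of q] q r2 by (simp add: circle_eq_def initial power2_norm_3)
  qed (use q in auto)
  with cl show False by contradiction
qed

lemma impossible: False
proof -
  obtain \<sigma> where \<sigma>: "continuous_on ({0..1} \<times> {-1..2}) (\<lambda>(t, s). \<sigma> t s)"
    and sq: "\<And>t s. t \<in> {0..1} \<Longrightarrow> s \<in> {-1..2} \<Longrightarrow> (\<sigma> t s)\<^sup>2 = - ring_eq (K t s)"
    and start: "\<And>t. t \<in> {0..1} \<Longrightarrow> 0 < Re (\<sigma> t (-1))"
    by (rule obtain_ring_sqrt) blast
  define \<tau> where "\<tau> = (\<lambda>t. csqrt (- mean_ring_eq r (c t)))"
  \<comment> \<open>Up to a positive factor, \<open>b\<close> is the cosine of half the lifted angle between rope and hoop, so its
    sign tells the two sheets of the double cover apart. On the pole the angle is constant.\<close>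
  define b where "b = (\<lambda>t s. Re (\<sigma> t (max (-1) (min 2 s)) * cnj (\<tau> t)))"
  have \<tau>_sq: "(\<tau> t)\<^sup>2 = - mean_ring_eq r (c t)" for t by (simp add: \<tau>_def)
  have \<tau>_nz: "\<tau> t \<noteq> 0" if "t \<in> {0..1}" for t
    using mean_ring_eq_slit[OF that] by (auto simp: \<tau>_def)
  have scale: "\<exists>k\<ge>0. ring_eq (K t s) = - of_real k * (\<sigma> t (max (-1) (min 2 s)))\<^sup>2"
    if t: "t \<in> {0..1}" and s: "s \<in> {-2..3}" for t s
  proof -
    \<comment> \<open>Up the pole \<open>ring_eq\<close> runs through real values from -3 to 0, so
      the clamped \<open>\<sigma>\<close> still has the right argument.\<close>
    have pole: "\<exists>k\<ge>0. ring_eq (vector [0, 0, z]) = - of_real k * 3" if "z \<in> {0..1}" for z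
    proof (intro exI conjI)
      have "0 \<le> (1 - z) * (3 - z)" using that by simp
      then show "0 \<le> ((2 - z)\<^sup>2 - 1) / 3" by (simp add: power2_eq_square algebra_simps)
      show "ring_eq (vector [0, 0, z]) = - of_real (((2 - z)\<^sup>2 - 1) / 3) * 3"
        by (simp add: ring_eq_def complex_eq_iff power2_commute[of z 2] field_simps)
    qed
    consider "s \<in> {-2..-1}" | "s \<in> {-1..2}" | "s \<in> {2..3}" using s by force
    then show ?thesis
    proof cases
      case 1
      then have "max (-1) (min 2 s) = -1" by auto
      then show ?thesis
        using 1 extended_rope_simps(1)[OF ends[OF t], of s] sq[OF t, of "-1"] ring_eq_K_at_origin[OF t] pole[of "-1-s"] by auto
    next
      case 2
      then have "max (-1) (min 2 s) = s" by auto
      then show ?thesis using sq[OF t 2] by (intro exI[of _ 1]) simp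
    next
      case 3
      then have "max (-1) (min 2 s) = 2" by auto
      then show ?thesis
        using 3 extended_rope_simps(5)[OF ends[OF t], of s] sq[OF t, of 2] ring_eq_K_at_origin[OF t] pole[of "s-2"] by auto
    qed
  qed
  \<comment> \<open>If \<open>b\<close> vanished, \<open>\<sigma>\<close> would be an imaginary
    multiple of \<open>\<tau>\<close>, making \<open>ring_eq\<close> a non-positive multiple of the
    mean; \<open>cap_not_opposite\<close> forbids this.\<close>
  have b_nz: "b t s \<noteq> 0" if t: "t \<in> {0..1}" and s: "s \<in> {-2..3}" and cap: "F t s \<in> \<real>\<^sub>\<le>\<^sub>0" for t s
  proof
    assume 0: "b t s = 0"
    define S where "S = \<sigma> t (max (-1) (min 2 s))"
    define \<kappa> where "\<kappa> = Im (S * cnj (\<tau> t)) / (cmod (\<tau> t))\<^sup>2"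
    have "S * cnj (\<tau> t) = \<i> * of_real (Im (S * cnj (\<tau> t)))"
      using 0 by (simp add: b_def S_def complex_eq_iff)
    then have "S * (cnj (\<tau> t) * \<tau> t) = \<i> * of_real (Im (S * cnj (\<tau> t))) * \<tau> t"
      by (metis mult.assoc)
    moreover have "cnj (\<tau> t) * \<tau> t = of_real ((cmod (\<tau> t))\<^sup>2)"
      by (simp add: complex_norm_square mult.commute del: of_real_power)
    ultimately have "S = \<i> * of_real \<kappa> * \<tau> t"
      using \<tau>_nz[OF t] by (simp add: \<kappa>_def field_simps)
    then have S2: "S\<^sup>2 = of_real (\<kappa>\<^sup>2) * mean_ring_eq r (c t)"
      by (simp add: power_mult_distrib \<tau>_sq)
    from scale[OF t s] obtain k where k: "k \<ge> 0" "ring_eq (K t s) = - of_real k * S\<^sup>2"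
      by (auto simp: S_def)
    have "ring_eq (K t s) = - of_real (k * \<kappa>\<^sup>2) * mean_ring_eq r (c t)"
      unfolding k(2) S2 by simp
    moreover obtain a where "0 \<le> a"
      "circle_eq r (c t) (n t) (K t s) = - of_real a * circle_eq r (c t) (n t) (vector [0, 0, 1])"
      by (rule K_cap[OF t cap])
    ultimately show False
      using cap_not_opposite[OF unlinked[OF t], of a "k * \<kappa>\<^sup>2"] k(1) by auto
  qed
  have cross: "\<exists>m. m \<in> {0<..<1} \<and> \<gamma> t m = vector [0, 0, 2] \<and> (\<forall>u\<in>{0..<m}. \<gamma> t u $ 2 < 0) \<and> (\<forall>u\<in>{m<..1}. 0 < \<gamma> t u $ 2)"
    if t: "t \<in> {0, 1}" for t
  proof -
    have t': "t \<in> {0..1}" using t by auto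
    have "continuous_on {0..1} (\<gamma> t)"
      by (rule continuous_on_section[OF cont_rope t'])
    from rope_polygon_crossing[OF this polygon[OF t] ends[OF t'], of 0]
    obtain m where "m \<in> {0<..<1}" "\<gamma> t m = vector [0, 0, 2]"
      "\<And>u. u \<in> {0..<m} \<Longrightarrow> \<gamma> t u $ 2 < 0" "\<And>u. u \<in> {m<..1} \<Longrightarrow> 0 < \<gamma> t u $ 2"
      by auto
    then show ?thesis by blast
  qed
  have \<sigma>_cont: "continuous_on {-1..2} (\<sigma> t)" if "t \<in> {0..1}" for t
    by (rule continuous_on_section[OF \<sigma> that])
  have \<tau>_re: "0 < Re (\<tau> t)" and \<tau>_prod: "Re (\<tau> t) * Im (\<tau> t) = - (c t $ 2)" if "t \<in> {0..1}" for t
    using csqrt_right_half_plane[OF mean_ring_eq_slit[OF that]]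
    by (simp_all add: \<tau>_def mean_ring_eq_def ring_eq_def)
  \<comment> \<open>Here \<open>\<sigma>\<close> and \<open>\<tau>\<close> both lie in the first
    quadrant.\<close>
  have b_initial: "0 < b 0 s" if s: "s \<in> {-2..3}" and cap: "F 0 s \<in> \<real>\<^sub>\<le>\<^sub>0" for s
  proof -
    obtain m where m: "m \<in> {0<..<1}" "\<gamma> 0 m = vector [0, 0, 2]"
      "\<And>u. u \<in> {0..<m} \<Longrightarrow> \<gamma> 0 u $ 2 < 0" "\<And>u. u \<in> {m<..1} \<Longrightarrow> 0 < \<gamma> 0 u $ 2"
      using cross[of 0] by auto
    have 0: "0 \<in> {0..1::real}" by simp
    have sm: "s \<in> {-1<..<m}"
      using extended_rope_sign(1)[OF ends[OF 0] m s] initial_cap[OF cap] by simp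
    note quad = ring_eq_sqrt_quadrants[OF ends[OF 0] m \<sigma>_cont[OF 0] start[OF 0] sq[OF 0]]
    have "0 < Im (\<sigma> 0 s)" "0 < Re (\<sigma> 0 s)" using quad(1,2)[of s] sm m(1) by auto
    moreover have "0 < Re (\<tau> 0) * Im (\<tau> 0)" unfolding \<tau>_prod[OF 0] by (simp add: initial)
    then have "0 < Im (\<tau> 0)" using \<tau>_re[OF 0] by (simp add: zero_less_mult_iff)
    moreover have "max (-1) (min 2 s) = s" using sm m(1) by auto
    ultimately show ?thesis using \<tau>_re[OF 0] by (simp add: b_def add_pos_pos)
  qed
  \<comment> \<open>Here \<open>\<sigma>\<close> lies in the second quadrant and
    \<open>\<tau>\<close> in the fourth.\<close>
  have b_final: "b 1 s < 0" if s: "s \<in> {-2..3}" and cap: "F 1 s \<in> \<real>\<^sub>\<le>\<^sub>0" for s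
  proof -
    obtain m where m: "m \<in> {0<..<1}" "\<gamma> 1 m = vector [0, 0, 2]"
      "\<And>u. u \<in> {0..<m} \<Longrightarrow> \<gamma> 1 u $ 2 < 0" "\<And>u. u \<in> {m<..1} \<Longrightarrow> 0 < \<gamma> 1 u $ 2"
      using cross[of 1] by auto
    have 1: "1 \<in> {0..1::real}" by simp
    have sm: "s \<in> {m<..<2}"
      using extended_rope_sign(2)[OF ends[OF 1] m s] final_cap[OF cap] by simp
    note quad = ring_eq_sqrt_quadrants[OF ends[OF 1] m \<sigma>_cont[OF 1] start[OF 1] sq[OF 1]]
    have "0 < Im (\<sigma> 1 s)" "Re (\<sigma> 1 s) < 0" using quad(1,3)[of s] sm m(1) by auto
    moreover have "Re (\<tau> 1) * Im (\<tau> 1) < 0" unfolding \<tau>_prod[OF 1] by (simp add: final)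
    then have "Im (\<tau> 1) < 0" using \<tau>_re[OF 1] by (simp add: mult_less_0_iff)
    moreover have "max (-1) (min 2 s) = s" using sm m(1) by auto
    ultimately show ?thesis using \<tau>_re[OF 1]
      by (simp add: b_def add_neg_neg mult_neg_pos mult_pos_neg)
  qed
  \<comment> \<open>Only crossings with \<open>b > 0\<close> survive in \<open>G\<close>. At time 1
    none is left, so that loop stays in the slit plane.\<close>
  define G where "G = (\<lambda>t s. blend (F t s) (b t s))"
  have b_cont: "continuous_on ({0..1} \<times> {-2..3}) (\<lambda>x. b (fst x) (snd x))"
  proof -
    have "continuous_on ({0..1} \<times> {-2..3}) (\<lambda>x. (\<lambda>(t, s). \<sigma> t s) (fst x, max (-1) (min 2 (snd x))))"
      by (rule continuous_on_compose2[OF \<sigma>]) (auto intro!: continuous_intros)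
    moreover have "continuous_on {0..1} \<tau>"
      unfolding \<tau>_def
      by (rule continuous_on_compose2[OF continuous_on_csqrt])
        (use mean_ring_eq_slit in \<open>auto simp: mean_ring_eq_def ring_eq_def intro!: continuous_intros cont_c\<close>)
    then have "continuous_on ({0..1} \<times> {-2..3::real}) (\<lambda>x. \<tau> (fst x))"
      by (rule continuous_on_compose2) (auto intro!: continuous_intros)
    ultimately show ?thesis
      unfolding b_def by (intro continuous_intros) simp_all
  qed
  have G_cont: "continuous_on ({0..1} \<times> {-2..3}) (\<lambda>(t, s). G t s)"
    unfolding G_def case_prod_unfold
    by (intro continuous_intros b_cont) (use b_nz in auto)
  have G_off: "G t s \<notin> \<real>\<^sub>\<le>\<^sub>0" if "F t s \<notin> \<real>\<^sub>\<le>\<^sub>0" for t s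
    unfolding G_def blend_def using that by (intro slit_plane_starlike blend_weight_bounds)
  have G_nz: "G t s \<noteq> 0" if "t \<in> {0..1}" "s \<in> {-2..3}" for t s
  proof (cases "F t s \<in> \<real>\<^sub>\<le>\<^sub>0")
    case True
    then show ?thesis
      using blend_nonpos[OF True, of "b t s"] b_nz[OF that True] F_nonzero[OF that]
      by (cases "0 < b t s") (auto simp: G_def)
  qed (use G_off in force)
  have G_ends: "G t (-2) = 1" "G t 3 = 1" if "t \<in> {0..1}" for t
    using F_ends[OF that] by (simp_all add: G_def)
  have "closed_log_on (-2) 3 (G 1)"
  proof (rule closed_log_on_slit_plane)
    show "continuous_on {-2..3} (G 1)"
      by (rule continuous_on_section[OF G_cont]) simp
    show "G 1 (-2) = G 1 3" using G_ends by simp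
    show "G 1 s \<notin> \<real>\<^sub>\<le>\<^sub>0" if "s \<in> {-2..3}" for s
      using G_off[of 1 s] blend_nonpos(2)[of "F 1 s" "b 1 s"] b_final[OF that]
      by (cases "F 1 s \<in> \<real>\<^sub>\<le>\<^sub>0") (auto simp: G_def)
  qed
  then have "closed_log_on (-2) 3 (G 0)"
    using G_ends by (intro closed_log_on_homotopy[OF _ G_cont G_nz, of 1 0]) auto
  \<comment> \<open>At time 0 every crossing has \<open>b > 0\<close>, so \<open>F 0\<close> and
    \<open>G 0\<close> agree there; elsewhere the segment between them stays in the slit plane.
    Hence the straight homotopy avoids 0.\<close>
  moreover define H where "H = (\<lambda>u s. of_real u * F 0 s + of_real (1 - u) * G 0 s)"
  ultimately have "closed_log_on (-2) 3 (H 0)" by simp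
  then have "closed_log_on (-2) 3 (H 1)"
  proof (rule closed_log_on_homotopy[rotated -1])
    have "continuous_on ({0..1} \<times> {-2..3}) (\<lambda>x. (\<lambda>(t, s). G t s) (0 :: real, snd x :: real))"
      by (rule continuous_on_compose2[OF G_cont]) (auto intro!: continuous_intros)
    then show "continuous_on ({0..1} \<times> {-2..3}) (\<lambda>(u, s). H u s)"
      unfolding H_def case_prod_unfold by (intro continuous_intros) auto
    show "H u s \<noteq> 0" if u: "u \<in> {0..1}" and s: "s \<in> {-2..3}" for u s
    proof (cases "F 0 s \<in> \<real>\<^sub>\<le>\<^sub>0")
      case True
      then have "G 0 s = F 0 s" using blend_nonpos(1)[OF True b_initial[OF s True]] by (simp add: G_def)
      then have "H u s = F 0 s" by (simp add: H_def algebra_simps)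
      then show ?thesis using F_nonzero[of 0 s] s by simp
    next
      case False
      \<comment> \<open>Blending twice with 1 is a single blend with this combined weight.\<close>
      define w where "w = u + (1 - u) * blend_weight (F 0 s) (b 0 s)"
      have "H u s = of_real w * F 0 s + of_real (1 - w)"
        by (simp add: H_def G_def blend_def w_def algebra_simps)
      moreover have "0 \<le> w" "w \<le> 1"
        using u blend_weight_bounds[of "F 0 s" "b 0 s"] mult_left_le[of "blend_weight (F 0 s) (b 0 s)" "1 - u"]
        by (auto simp: w_def)
      ultimately have "H u s \<notin> \<real>\<^sub>\<le>\<^sub>0" using slit_plane_starlike[OF False] by simp
      then show ?thesis by force
    qed
    show "H u (-2) = H u 3" for u using F_ends[of 0] G_ends[of 0] by (simp add: H_def)
  qed auto
  moreover have "H 1 = F 0" by (simp add: H_def)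
  ultimately show False using F_0_no_closed_log by simp
qed

end

theorem theorem1p3:
  fixes r :: real
  assumes "1 \<le> r" and "r < 2"
  shows "\<not> (\<exists>(g :: real \<Rightarrow> real^3 \<Rightarrow> real^3) (\<gamma> :: real \<Rightarrow> real \<Rightarrow> real^3).
      (\<forall>t\<in>{0..1}. orientation_preserving_isometry (g t))
    \<and> continuous_on ({0..1} \<times> UNIV) (\<lambda>(t, x). g t x)
    \<and> g 0 = id
    \<and> continuous_on ({0..1} \<times> {0..1}) (\<lambda>(t, s). \<gamma> t s)
    \<and> g 1 ` hoop_minus r = hoop_plus r
    \<and> (\<forall>t\<in>{0, 1}. inj_on (\<gamma> t) {0..1} \<and> \<gamma> t ` {0..1} = rope_polygon)
    \<and> (\<forall>t\<in>{0..1}. \<gamma> t 0 = vector [0, -1, 0] \<and> \<gamma> t 1 = vector [0, 1, 0]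
          \<and> (\<forall>s\<in>{0<..<1}. \<gamma> t s \<in> upper_half_space))
    \<and> (\<forall>t\<in>{0..1}. g t ` hoop_minus r \<subseteq> upper_half_space)
    \<and> (\<forall>t\<in>{0..1}. \<gamma> t ` {0..1} \<inter> g t ` hoop_minus r = {}
          \<and> \<gamma> t ` {0..1} \<inter> pole = {}
          \<and> g t ` hoop_minus r \<inter> pole = {}))"
proof (rule notI, elim exE conjE)
  fix g :: "real \<Rightarrow> real^3 \<Rightarrow> real^3" and \<gamma> :: "real \<Rightarrow> real \<Rightarrow> real^3"
  assume iso: "\<forall>t\<in>{0..1}. orientation_preserving_isometry (g t)"
    and g_cont: "continuous_on ({0..1} \<times> UNIV) (\<lambda>(t, x). g t x)" and g_0: "g 0 = id"
    and rope_cont: "continuous_on ({0..1} \<times> {0..1}) (\<lambda>(t, s). \<gamma> t s)"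
    and g_1: "g 1 ` hoop_minus r = hoop_plus r"
    and polygon: "\<forall>t\<in>{0, 1}. inj_on (\<gamma> t) {0..1} \<and> \<gamma> t ` {0..1} = rope_polygon"
    and ends: "\<forall>t\<in>{0..1}. \<gamma> t 0 = vector [0, -1, 0] \<and> \<gamma> t 1 = vector [0, 1, 0]
          \<and> (\<forall>s\<in>{0<..<1}. \<gamma> t s \<in> upper_half_space)"
    and above: "\<forall>t\<in>{0..1}. g t ` hoop_minus r \<subseteq> upper_half_space"
    and disjoint: "\<forall>t\<in>{0..1}. \<gamma> t ` {0..1} \<inter> g t ` hoop_minus r = {}
          \<and> \<gamma> t ` {0..1} \<inter> pole = {} \<and> g t ` hoop_minus r \<inter> pole = {}"
  have dist: "\<forall>x y. dist (g t x) (g t y) = dist x y" if "t \<in> {0..1}" for t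
    using iso that by (simp add: orientation_preserving_isometry_def)
  have g_cont': "continuous_on {0..1} (\<lambda>t. g t x)" for x
  proof -
    have "continuous_on {0..1} (\<lambda>t. (\<lambda>(t, x). g t x) (t, x))"
      by (rule continuous_on_compose2[OF g_cont]) (auto intro!: continuous_intros)
    then show ?thesis by simp
  qed
  define c0 :: "real^3" where "c0 = vector [0, -1/2, 2]"
  define e :: "real^3" where "e = vector [0, 1, 0]"
  define c where "c = (\<lambda>t. g t c0)"
  define n where "n = (\<lambda>t. g t (c0 + e) - g t c0)"
  have frame: "g 1 c0 = vector [0, 1/2, 2]" "n 1 $ 1 = 0" "n 1 $ 2 \<noteq> 0" "n 1 $ 3 = 0"
    using hoop_plus_frame[OF dist g_1 _ c0_def e_def] \<open>1 \<le> r\<close> by (simp_all add: n_def)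
  have hoop: "p \<in> g t ` hoop_minus r" if t: "t \<in> {0..1}" and p: "circle_eq r (c t) (n t) p = 0" for t p
  proof -
    obtain q where q: "p = g t q" using circle_eq_isometry(2)[OF dist[OF t]] by (metis surjD)
    then have "circle_eq r c0 e q = 0"
      using p circle_eq_isometry(1)[OF dist[OF t]] by (simp add: c_def n_def)
    then show ?thesis using q by (simp add: hoop_minus_iff c0_def e_def)
  qed
  have "hoop_motion r c n \<gamma>"
  proof
    show "continuous_on {0..1} c" "continuous_on {0..1} n"
      unfolding c_def n_def by (intro continuous_intros g_cont')+
    show "c 0 = vector [0, -1/2, 2]" "n 0 = vector [0, 1, 0]"
      by (simp_all add: c_def n_def g_0 c0_def e_def)
    show "c 1 = vector [0, 1/2, 2]" "n 1 $ 1 = 0" "n 1 $ 2 \<noteq> 0" "n 1 $ 3 = 0"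
      using frame by (simp_all add: c_def)
    show "0 < p $ 3 \<and> p \<notin> pole \<and> p \<notin> \<gamma> t ` {0..1}"
      if "t \<in> {0..1}" "circle_eq r (c t) (n t) p = 0" for t p
      using hoop[OF that] above disjoint that(1) unfolding upper_half_space_def by blast
    show "\<gamma> t s \<notin> pole" if "t \<in> {0..1}" "s \<in> {0..1}" for t s
      using disjoint that by blast
  qed (use \<open>1 \<le> r\<close> \<open>r < 2\<close> rope_cont polygon ends in auto)
  then show False by (rule hoop_motion.impossible)
qed

end
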